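(* Let $(B_t)_{t\ge 0}$ be a standard Brownian motion in $\mathbb{R}^d$, $d\geq 1$. Let $f:[0,1]\to\mathbb{R}^d$ be a càdlàg function and let $A$ be a non-empty subset of $[0,1]$. Then there exist (deterministic) constants $c_3$ and $c_4$ such that, almost surely, $$\underline{\dim}_M G_A(B+f) = c_3 \quad\text{and}\quad \overline{\dim}_M G_A(B+f) = c_4.$$
   Context: For a function $h:[0,1]\to\mathbb{R}^d$ and $A\subseteq[0,1]$, $G_A(h)=\{(t,h(t)):t\in A\}\subset\mathbb{R}^{d+1}$ denotes the graph of $h$ over $A$; $(B+f)(t)=B_t+f(t)$. For a non-empty bounded set $E\subset\mathbb{R}^m$ and $\epsilon>0$, let $P(E,\epsilon)$ be the maximum number of pairwise disjoint balls of radius $\epsilon$ with centers in $E$. The upper and lower Minkowski (box) dimensions of $E$ are $$\overline{\dim}_M(E)=\limsup_{\epsilon\to 0}\frac{\log P(E,\epsilon)}{\log \epsilon^{-1}},\qquad \underline{\dim}_M(E)=\liminf_{\epsilon\to 0}\frac{\log P(E,\epsilon)}{\log \epsilon^{-1}}.$$ *)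

theory Defs
  imports "HOL-Probability.Probability"
begin

text \<open>
  Maximal number of pairwise disjoint balls of radius \<open>\<epsilon>\<close> centred in \<open>E\<close>. The balls are indexed by
  their centres; in a nontrivial normed space distinct balls of equal radius have distinct
  centres. Meaningful for bounded \<open>E\<close> and \<open>\<epsilon> > 0\<close>, where (in Euclidean space) the maximum is
  over a finite set.
\<close>

definition packing_number :: "'a::metric_space set \<Rightarrow> real \<Rightarrow> nat" where
  "packing_number E \<epsilon> =
     Max {card C |C. finite C \<and> C \<subseteq> E \<and> disjoint_family_on (\<lambda>x. ball x \<epsilon>) C}"

definition upper_minkowski_dim :: "'a::metric_space set \<Rightarrow> ereal" where
  "upper_minkowski_dim E =
     Limsup (at_right 0) (\<lambda>\<epsilon>. ereal (ln (real (packing_number E \<epsilon>)) / ln (inverse \<epsilon>)))"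

definition lower_minkowski_dim :: "'a::metric_space set \<Rightarrow> ereal" where
  "lower_minkowski_dim E =
     Liminf (at_right 0) (\<lambda>\<epsilon>. ereal (ln (real (packing_number E \<epsilon>)) / ln (inverse \<epsilon>)))"

text \<open>The product type carries the Euclidean metric, so the graph lives in \<open>\<real>\<^sup>d\<^sup>+\<^sup>1\<close>.\<close>

definition graph_over :: "real set \<Rightarrow> (real \<Rightarrow> 'a) \<Rightarrow> (real \<times> 'a) set" where
  "graph_over A h = (\<lambda>t. (t, h t)) ` A"

text \<open>Only the values of \<open>f\<close> on \<open>[a, b]\<close> are relevant.\<close>

definition cadlag_on :: "real \<Rightarrow> real \<Rightarrow> (real \<Rightarrow> 'a::topological_space) \<Rightarrow> bool" where
  "cadlag_on a b f \<longleftrightarrow>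
     (\<forall>t\<in>{a..<b}. (f \<longlongrightarrow> f t) (at_right t)) \<and>
     (\<forall>t\<in>{a<..b}. \<exists>l. (f \<longlongrightarrow> l) (at_left t))"

text \<open>
  Time is \<open>[0, \<infinity>)\<close>; the values of \<open>B\<close> at negative times are irrelevant. The density in
  \<open>gaussian_increments\<close> is that of the centred Gaussian law on \<open>\<real>\<^sup>d\<close> with covariance
  \<open>(t - s) I\<close>.
\<close>

locale standard_brownian_motion = prob_space M
  for M :: "'w measure" and B :: "real \<Rightarrow> 'w \<Rightarrow> real ^ 'd" +
  assumes measurable_at: "\<And>t. 0 \<le> t \<Longrightarrow> random_variable borel (B t)"
    and starts_at_0: "AE \<omega> in M. B 0 \<omega> = 0"
    and independent_increments:
      "\<And>(t :: nat \<Rightarrow> real) n. 0 \<le> t 0 \<Longrightarrow> (\<And>i. i < n \<Longrightarrow> t i \<le> t (Suc i)) \<Longrightarrow>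
         indep_vars (\<lambda>_. borel) (\<lambda>i \<omega>. B (t (Suc i)) \<omega> - B (t i) \<omega>) {..<n}"
    and gaussian_increments:
      "\<And>s t. 0 \<le> s \<Longrightarrow> s < t \<Longrightarrow>
         distributed M lborel (\<lambda>\<omega>. B t \<omega> - B s \<omega>)
           (\<lambda>x. ennreal (\<Prod>i\<in>UNIV. normal_density 0 (sqrt (t - s)) (x $ i)))"
    and continuous_paths: "AE \<omega> in M. continuous_on {0..} (\<lambda>t. B t \<omega>)"

end

theory Submission
  imports Defs
begin

text \<open>
  On \<open>[0, 1]\<close>, a Brownian path is the sum of its piecewise linear interpolation at the dyadic points of
  level \<open>n\<close>, which is a Lipschitz function, and of a remainder which depends only on the second
  differences of \<open>B\<close> at the dyadic points of levels at least \<open>n\<close>. Adding a Lipschitz function \<open>g\<close> changes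
  a graph by the bi-Lipschitz map \<open>(t, x) \<mapsto> (t, x + g t)\<close>, so the Minkowski dimensions are functions of
  the remainder, for every \<open>n\<close>. The second differences of distinct levels are independent, because
  \<open>X + Y\<close> and \<open>X - Y\<close> are independent for independent Gaussian \<open>X\<close> and \<open>Y\<close> of equal variance. Hence
  the dimensions are measurable with respect to a tail \<open>\<sigma>\<close>-algebra, and almost surely constant by
  Kolmogorov's zero-one law. They are finite because a cadlag function is bounded.
\<close>

section \<open>Packing rates\<close>

text \<open>Independence across levels needs more than one application of the \<open>X + Y\<close>,
  \<open>X - Y\<close> fact. The increments of level \<open>m\<close> are sums of neighbouring
  increments of level \<open>m + 1\<close>, and the second differences of level \<open>m\<close> are
  the corresponding differences. They are therefore independent of the whole level \<open>m\<close>,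
  which already determines all coarser second differences; induction on the largest level involved
  gives mutual independence. The main obstacle is measurability. The dimensions involve uncountably
  many radii and a possibly uncountable set \<open>A\<close> of times. Radii are reduced to
  rationals by a one-sided comparison of packing rates at nearby radii. Times are reduced to a
  countable subset of \<open>A\<close>, chosen from the graph of \<open>f\<close> before any path is
  given: density in \<open>A\<close> alone would not do, since \<open>f\<close> may jump. The
  remainder of the path is defined as a limit at every sample point, so that it is measurable with
  respect to the fine levels even where the path is not continuous.\<close>

definition separated :: "real \<Rightarrow> 'a::metric_space set \<Rightarrow> bool" where
  "separated r C \<longleftrightarrow> pairwise (\<lambda>x y. r \<le> dist x y) C"

text \<open>
  In contrast to the maximum in the definition of the packing number, the supremum in
  \<open>ereal\<close> is meaningful for every set, bounded or not, so the comparison and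
  measurability arguments need no boundedness.
\<close>

definition packing_rate :: "'a::metric_space set \<Rightarrow> real \<Rightarrow> ereal" where
  "packing_rate E \<epsilon> = (SUP C \<in> {C. finite C \<and> C \<subseteq> E \<and> separated (2 * \<epsilon>) C}.
     ereal (ln (real (card C)) / ln (inverse \<epsilon>)))"

definition upper_rate :: "'a::metric_space set \<Rightarrow> ereal" where
  "upper_rate E = Limsup (at_right 0) (packing_rate E)"

definition lower_rate :: "'a::metric_space set \<Rightarrow> ereal" where
  "lower_rate E = Liminf (at_right 0) (packing_rate E)"

text \<open>The case \<open>n = 0\<close> uses the convention \<open>ln 0 = 0\<close>, which also
  makes the empty family contribute \<open>0\<close> to a packing rate.\<close>

lemma ln_real_nat_nonneg [simp]: "0 \<le> ln (real n)"
  by (cases n) auto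

lemma ln_inverse_pos: "0 < \<epsilon> \<Longrightarrow> \<epsilon> < 1 \<Longrightarrow> 0 < ln (inverse \<epsilon> :: real)"
  by (simp add: one_less_inverse)

lemma separated_empty [simp]: "separated r {}"
  by (simp add: separated_def)

lemma separated_mono: "separated r C \<Longrightarrow> s \<le> r \<Longrightarrow> separated s C"
  unfolding separated_def pairwise_def by (meson order_trans)

lemma packing_rate_nonneg: "0 \<le> packing_rate E \<epsilon>"
  unfolding packing_rate_def by (rule SUP_upper2[where i="{}"]) auto

text \<open>Images of separated points keep a positive distance, so \<open>p\<close> is injective on
  a separated family and preserves its cardinality; the factor only exchanges the normalising
  logarithms. As \<open>p\<close> is constrained only at distances at least
  \<open>2 * \<epsilon>\<close>, it may be discontinuous or collapse close points.\<close>

lemma packing_rate_scale: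
  fixes E :: "'a::metric_space set" and E' :: "'b::metric_space set"
  assumes "1 \<le> L" "0 < \<epsilon>" "\<epsilon> < 1" "p ` E \<subseteq> E'"
    and sep: "\<And>x y. x \<in> E \<Longrightarrow> y \<in> E \<Longrightarrow> 2 * \<epsilon> \<le> dist x y \<Longrightarrow> 2 * (\<epsilon> / L) \<le> dist (p x) (p y)"
  shows "packing_rate E \<epsilon> \<le> ereal (ln (inverse (\<epsilon> / L)) / ln (inverse \<epsilon>)) * packing_rate E' (\<epsilon> / L)"
proof (subst packing_rate_def, rule SUP_least)
  fix C assume "C \<in> {C. finite C \<and> C \<subseteq> E \<and> separated (2 * \<epsilon>) C}"
  then have C: "finite C" "C \<subseteq> E" "separated (2 * \<epsilon>) C" by auto
  have pd: "2 * (\<epsilon> / L) \<le> dist (p x) (p y)" if "x \<in> C" "y \<in> C" "x \<noteq> y" for x y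
    using C sep that unfolding separated_def pairwise_def by blast
  have "0 < \<epsilon> / L" using assms by simp
  have inj: "inj_on p C"
  proof (rule inj_onI, rule ccontr)
    fix x y assume "x \<in> C" "y \<in> C" "p x = p y" "x \<noteq> y"
    with pd[of x y] \<open>0 < \<epsilon> / L\<close> show False by auto
  qed
  have "\<epsilon> / L < 1"
    using assms by (simp add: divide_less_eq)
  then have l: "0 < ln (inverse \<epsilon>)" "0 < ln (inverse (\<epsilon> / L))"
    using ln_inverse_pos[of \<epsilon>] ln_inverse_pos[of "\<epsilon> / L"] assms \<open>0 < \<epsilon> / L\<close> by blast+
  have "separated (2 * (\<epsilon> / L)) (p ` C)"
    unfolding separated_def pairwise_def using pd by auto
  then have "ereal (ln (real (card (p ` C))) / ln (inverse (\<epsilon> / L))) \<le> packing_rate E' (\<epsilon> / L)"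
    unfolding packing_rate_def using C assms(4)
    by (intro SUP_upper) auto
  then have *: "ereal (ln (inverse (\<epsilon> / L)) / ln (inverse \<epsilon>)) * ereal (ln (real (card C)) / ln (inverse (\<epsilon> / L)))
     \<le> ereal (ln (inverse (\<epsilon> / L)) / ln (inverse \<epsilon>)) * packing_rate E' (\<epsilon> / L)"
    using l inj by (intro ereal_mult_left_mono) (auto simp: card_image simp del: ln_inverse)
  have "ln (inverse (\<epsilon> / L)) / ln (inverse \<epsilon>) * (ln (real (card C)) / ln (inverse (\<epsilon> / L)))
     = ln (real (card C)) / ln (inverse \<epsilon>)"
    using l by (simp add: field_simps del: ln_inverse)
  then show "ereal (ln (real (card C)) / ln (inverse \<epsilon>)) \<le>
     ereal (ln (inverse (\<epsilon> / L)) / ln (inverse \<epsilon>)) * packing_rate E' (\<epsilon> / L)"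
    using * by (simp del: ln_inverse)
qed

text \<open>The ratio is \<open>1 + ln L / ln (inverse \<epsilon>)\<close>, so a constant change of
  scale is invisible to logarithmic rates.\<close>

lemma log_scale_tendsto_1:
  assumes "1 \<le> (L::real)"
  shows "((\<lambda>\<epsilon>. ln (inverse (\<epsilon> / L)) / ln (inverse \<epsilon>)) \<longlongrightarrow> 1) (at_right 0)"
proof -
  have "filterlim (\<lambda>\<epsilon>::real. ln (inverse \<epsilon>)) at_top (at_right 0)"
    by (rule filterlim_compose[OF ln_at_top filterlim_inverse_at_top_right])
  then have "((\<lambda>\<epsilon>. 1 + ln L / ln (inverse \<epsilon>)) \<longlongrightarrow> 1 + 0) (at_right 0)"
    by (intro tendsto_add tendsto_const real_tendsto_divide_at_top[OF tendsto_const])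
  moreover have "\<forall>\<^sub>F \<epsilon> in at_right 0. 1 + ln L / ln (inverse \<epsilon>) = ln (inverse (\<epsilon> / L)) / ln (inverse \<epsilon>)"
    using eventually_at_right_real[OF zero_less_one]
  proof eventually_elim
    case (elim \<epsilon>)
    then have "0 < ln (inverse \<epsilon>)" by (intro ln_inverse_pos) auto
    with elim assms show ?case
      by (simp add: field_simps ln_div)
  qed
  ultimately show ?thesis
    by (simp add: tendsto_cong)
qed

lemma at_right_scale:
  assumes "0 < (L::real)"
  shows "filtermap (\<lambda>\<epsilon>. \<epsilon> / L) (at_right 0) = at_right 0"
  using filtermap_times_pos_at_right[of "inverse L" 0] assms
  by (simp add: divide_inverse mult.commute[of _ "inverse L"])

lemma ereal_le_of_le_mult:
  fixes x y :: ereal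
  assumes "0 \<le> y" "\<And>\<delta>::real. 0 < \<delta> \<Longrightarrow> x \<le> ereal (1 + \<delta>) * y"
  shows "x \<le> y"
proof (cases y)
  case (real r)
  have "((\<lambda>\<delta>. ereal ((1 + \<delta>) * r)) \<longlongrightarrow> ereal ((1 + 0) * r)) (at_right 0)"
    by (intro tendsto_intros lim_ereal[THEN iffD2])
  moreover have "\<forall>\<^sub>F \<delta> in at_right 0. x \<le> ereal ((1 + \<delta>) * r)"
    using eventually_at_right_less[of "0::real"] assms(2) real by (auto elim: eventually_mono)
  ultimately show ?thesis
    using real tendsto_lowerbound[of "\<lambda>\<delta>. ereal ((1 + \<delta>) * r)" "ereal r" "at_right (0::real)" x] by simp
qed (use assms in auto)

text \<open>The map \<open>p\<close> may depend on \<open>\<epsilon>\<close>, as it must when points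
  are moved by a fraction of \<open>\<epsilon>\<close>. The substitution of
  \<open>\<epsilon> / L\<close> for \<open>\<epsilon>\<close> preserves the filter at
  \<open>0\<close>, and the remaining logarithmic factor is eventually below
  \<open>1 + \<delta>\<close> for every \<open>\<delta>\<close>.\<close>

lemma rates_le:
  fixes E :: "'a::metric_space set" and E' :: "'b::metric_space set"
  assumes L: "1 \<le> L"
    and sep: "\<And>\<epsilon>. 0 < \<epsilon> \<Longrightarrow> \<exists>p. p ` E \<subseteq> E' \<and>
      (\<forall>x\<in>E. \<forall>y\<in>E. 2 * \<epsilon> \<le> dist x y \<longrightarrow> 2 * (\<epsilon> / L) \<le> dist (p x) (p y))"
  shows "upper_rate E \<le> upper_rate E'" "lower_rate E \<le> lower_rate E'"
proof -
  let ?r = "\<lambda>\<epsilon>. ln (inverse (\<epsilon> / L)) / ln (inverse \<epsilon>)"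
  have inj: "inj (\<lambda>\<epsilon>. \<epsilon> / L)"
    using L by (auto intro!: injI)
  have ev: "\<forall>\<^sub>F \<epsilon> in at_right 0. packing_rate E \<epsilon> \<le> ereal (1 + \<delta>) * packing_rate E' (\<epsilon> / L)" if "0 < \<delta>" for \<delta>
  proof -
    have "\<forall>\<^sub>F \<epsilon> in at_right 0. ?r \<epsilon> < 1 + \<delta>"
      using log_scale_tendsto_1[OF L] that by (intro order_tendstoD) auto
    with eventually_at_right_real[OF zero_less_one] show ?thesis
    proof eventually_elim
      case (elim \<epsilon>)
      obtain p where p: "p ` E \<subseteq> E'"
        "\<And>x y. x \<in> E \<Longrightarrow> y \<in> E \<Longrightarrow> 2 * \<epsilon> \<le> dist x y \<Longrightarrow> 2 * (\<epsilon> / L) \<le> dist (p x) (p y)"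
        using sep[of \<epsilon>] elim by auto
      have "packing_rate E \<epsilon> \<le> ereal (?r \<epsilon>) * packing_rate E' (\<epsilon> / L)"
        using elim by (intro packing_rate_scale[OF L _ _ p]) auto
      also have "\<dots> \<le> ereal (1 + \<delta>) * packing_rate E' (\<epsilon> / L)"
        using elim by (intro ereal_mult_right_mono packing_rate_nonneg) auto
      finally show ?case .
    qed
  qed
  have U: "Limsup (at_right 0) (\<lambda>\<epsilon>. packing_rate E' (\<epsilon> / L)) = upper_rate E'"
    using Limsup_filtermap_eq[OF inj, of "at_right 0" "packing_rate E'"] at_right_scale[of L] L
    by (simp add: upper_rate_def)
  have W: "Liminf (at_right 0) (\<lambda>\<epsilon>. packing_rate E' (\<epsilon> / L)) = lower_rate E'"
    using Liminf_filtermap_eq[OF inj, of "at_right 0" "packing_rate E'"] at_right_scale[of L] L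
    by (simp add: lower_rate_def)
  show "upper_rate E \<le> upper_rate E'"
  proof (rule ereal_le_of_le_mult)
    show "0 \<le> upper_rate E'"
      unfolding upper_rate_def by (rule le_Limsup) (auto simp: packing_rate_nonneg)
    fix \<delta> :: real assume "0 < \<delta>"
    from Limsup_mono[OF ev[OF this]] show "upper_rate E \<le> ereal (1 + \<delta>) * upper_rate E'"
      using \<open>0 < \<delta>\<close> by (simp add: Limsup_ereal_mult_left U flip: upper_rate_def)
  qed
  show "lower_rate E \<le> lower_rate E'"
  proof (rule ereal_le_of_le_mult)
    show "0 \<le> lower_rate E'"
      unfolding lower_rate_def by (rule Liminf_bounded) (auto simp: packing_rate_nonneg)
    fix \<delta> :: real assume "0 < \<delta>"
    from Liminf_mono[OF ev[OF this]] show "lower_rate E \<le> ereal (1 + \<delta>) * lower_rate E'"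
      using \<open>0 < \<delta>\<close> by (simp add: Liminf_ereal_mult_left W flip: lower_rate_def)
  qed
qed

text \<open>Moving each point by less than \<open>\<epsilon> / 2\<close> shortens a distance of at
  least \<open>2 * \<epsilon>\<close> to no less than \<open>\<epsilon>\<close>, whence the constant
  \<open>2\<close>. This allows a countable set of times to replace \<open>A\<close>.\<close>

lemma rates_dense:
  assumes "E' \<subseteq> E" "E \<subseteq> closure E'"
  shows "upper_rate E = upper_rate E'" "lower_rate E = lower_rate E'"
proof -
  have 1: "upper_rate E \<le> upper_rate E' \<and> lower_rate E \<le> lower_rate E'"
  proof (intro conjI rates_le[where L=2])
    fix \<epsilon> :: real assume "0 < \<epsilon>"
    have "\<exists>q\<in>E'. dist q x < \<epsilon> / 2" if "x \<in> E" for x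
      using assms that \<open>0 < \<epsilon>\<close> by (intro closure_approachable[THEN iffD1, rule_format]) auto
    then obtain p where p: "\<And>x. x \<in> E \<Longrightarrow> p x \<in> E' \<and> dist (p x) x < \<epsilon> / 2"
      by metis
    have "2 * (\<epsilon> / 2) \<le> dist (p x) (p y)" if "x \<in> E" "y \<in> E" "2 * \<epsilon> \<le> dist x y" for x y
    proof -
      have "dist x y \<le> dist (p x) x + dist (p x) (p y) + dist (p y) y"
        by (metis add_right_mono dist_commute dist_triangle2 dist_triangle3 order_trans)
      with p[OF that(1)] p[OF that(2)] that(3) show ?thesis by simp
    qed
    then show "\<exists>p. p ` E \<subseteq> E' \<and> (\<forall>x\<in>E. \<forall>y\<in>E. 2 * \<epsilon> \<le> dist x y \<longrightarrow> 2 * (\<epsilon> / 2) \<le> dist (p x) (p y))"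
      using p by (intro exI[of _ p]) auto
    then show "\<exists>p. p ` E \<subseteq> E' \<and> (\<forall>x\<in>E. \<forall>y\<in>E. 2 * \<epsilon> \<le> dist x y \<longrightarrow> 2 * (\<epsilon> / 2) \<le> dist (p x) (p y))" .
  qed auto
  have 2: "upper_rate E' \<le> upper_rate E \<and> lower_rate E' \<le> lower_rate E"
    using assms(1) by (intro conjI rates_le[where L=1]) (auto intro!: exI[of _ "\<lambda>x. x"])
  show "upper_rate E = upper_rate E'" "lower_rate E = lower_rate E'"
    using 1 2 by auto
qed

text \<open>Undoing the shear \<open>?p\<close> stretches distances by at most \<open>1 + K\<close>:
  the vertical correction is at most \<open>K\<close> times the time difference, which is itself at
  most the distance after the shear.\<close>

lemma rates_graph_add_lipschitz_le:
  fixes g h :: "real \<Rightarrow> 'a::real_normed_vector"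
  assumes "K-lipschitz_on A g"
  shows "upper_rate (graph_over A h) \<le> upper_rate (graph_over A (\<lambda>t. h t + g t))"
    "lower_rate (graph_over A h) \<le> lower_rate (graph_over A (\<lambda>t. h t + g t))"
proof -
  have K: "0 \<le> K" using assms by (rule lipschitz_on_nonneg)
  let ?p = "\<lambda>(t, x). (t, x + g t)"
  have "2 * (\<epsilon> / (1 + K)) \<le> dist (?p x) (?p y)"
    if "x \<in> graph_over A h" "y \<in> graph_over A h" "2 * \<epsilon> \<le> dist x y" for x y \<epsilon>
  proof -
    from that obtain s t where st: "s \<in> A" "t \<in> A" "x = (s, h s)" "y = (t, h t)"
      by (auto simp: graph_over_def)
    have "dist x y = norm ((s - t, (h s + g s) - (h t + g t)) + (0, g t - g s))"
      by (simp add: st dist_norm)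
    also have "\<dots> \<le> norm (s - t, (h s + g s) - (h t + g t)) + norm (0::real, g t - g s)"
      by (rule norm_triangle_ineq)
    also have "norm (s - t, (h s + g s) - (h t + g t)) = dist (?p x) (?p y)"
      by (simp add: st dist_norm)
    also have "norm (0::real, g t - g s) \<le> K * dist s t"
      using lipschitz_onD[OF assms st(2,1)] by (simp add: norm_Pair dist_norm abs_minus_commute)
    also have "dist s t \<le> dist (?p x) (?p y)"
      using dist_fst_le[of "?p x" "?p y"] by (simp add: st)
    finally have "dist x y \<le> (1 + K) * dist (?p x) (?p y)"
      using K by (simp add: distrib_right mult_left_mono)
    with that(3) K show ?thesis by (simp add: field_simps)
  qed
  then have *: "\<exists>p. p ` graph_over A h \<subseteq> graph_over A (\<lambda>t. h t + g t) \<and>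
      (\<forall>x\<in>graph_over A h. \<forall>y\<in>graph_over A h. 2 * \<epsilon> \<le> dist x y \<longrightarrow> 2 * (\<epsilon> / (1 + K)) \<le> dist (p x) (p y))" for \<epsilon>
    by (intro exI[of _ ?p]) (auto simp: graph_over_def)
  show "upper_rate (graph_over A h) \<le> upper_rate (graph_over A (\<lambda>t. h t + g t))"
    "lower_rate (graph_over A h) \<le> lower_rate (graph_over A (\<lambda>t. h t + g t))"
    by (rule rates_le[where L="1 + K"]; use K * in simp)+
qed

text \<open>The reverse inequalities come from shearing back by \<open>- g\<close>, which has the
  same Lipschitz constant.\<close>

lemma rates_graph_add_lipschitz:
  fixes g h :: "real \<Rightarrow> 'a::real_normed_vector"
  assumes "K-lipschitz_on A g"
  shows "upper_rate (graph_over A (\<lambda>t. h t + g t)) = upper_rate (graph_over A h)"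
    "lower_rate (graph_over A (\<lambda>t. h t + g t)) = lower_rate (graph_over A h)"
  using rates_graph_add_lipschitz_le[OF assms, of h]
    rates_graph_add_lipschitz_le[OF lipschitz_on_minus[OF assms], of "\<lambda>t. h t + g t"]
  by auto

text \<open>If the centres are closer than \<open>2 * \<epsilon>\<close>, the midpoint lies in both
  balls; this is where a linear structure is required.\<close>

lemma disjoint_balls_iff:
  fixes x y :: "'a::real_normed_vector"
  assumes "0 < \<epsilon>"
  shows "ball x \<epsilon> \<inter> ball y \<epsilon> = {} \<longleftrightarrow> 2 * \<epsilon> \<le> dist x y"
proof
  assume *: "ball x \<epsilon> \<inter> ball y \<epsilon> = {}"
  show "2 * \<epsilon> \<le> dist x y"
  proof (rule ccontr)
    assume "\<not> 2 * \<epsilon> \<le> dist x y"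
    then have "midpoint x y \<in> ball x \<epsilon> \<inter> ball y \<epsilon>"
      by (simp add: dist_midpoint)
    with * show False by blast
  qed
next
  assume "2 * \<epsilon> \<le> dist x y" then show "ball x \<epsilon> \<inter> ball y \<epsilon> = {}"
    by (intro disjoint_ballI) simp
qed

text \<open>Volume comparison: the disjoint balls of radius \<open>\<epsilon>\<close> lie in a ball
  of radius \<open>R + 1\<close>, because \<open>\<epsilon> < 1\<close>.\<close>

lemma card_separated_le:
  fixes C :: "'a::euclidean_space set"
  assumes C: "finite C" "C \<subseteq> ball 0 R" "separated (2 * \<epsilon>) C" and "0 < R" "0 < \<epsilon>" "\<epsilon> < 1"
  shows "real (card C) \<le> ((R + 1) / \<epsilon>) ^ DIM('a)"
proof -
  let ?c = "measure lborel (ball (0::'a) 1)"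
  have c: "0 < ?c" by (rule content_ball_pos) simp
  have disj: "disjoint_family_on (\<lambda>x. ball x \<epsilon>) C"
    using C(3) \<open>0 < \<epsilon>\<close> unfolding disjoint_family_on_def separated_def pairwise_def
    by (auto simp: disjoint_balls_iff)
  have fm: "ball x r \<in> fmeasurable lborel" for x :: 'a and r
    using emeasure_bounded_finite[OF bounded_ball[of x r]] by (simp add: fmeasurable_def)
  have "(\<Sum>x\<in>C. measure lborel (ball x \<epsilon>)) = measure lborel (\<Union>x\<in>C. ball x \<epsilon>)"
    using C(1) disj fm
    by (intro measure_finite_Union[symmetric]) (auto simp: fmeasurableD2)
  also have "\<dots> \<le> measure lborel (ball (0::'a) (R + 1))"
  proof (rule measure_mono_fmeasurable)
    show "(\<Union>x\<in>C. ball x \<epsilon>) \<subseteq> ball 0 (R + 1)"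
    proof safe
      fix x y assume "x \<in> C" "y \<in> ball x \<epsilon>"
      then have "norm x < R" "dist x y < \<epsilon>" using C(2) by auto
      then show "y \<in> ball 0 (R + 1)"
        using norm_triangle_sub[of y x] \<open>\<epsilon> < 1\<close> by (simp add: dist_norm norm_minus_commute)
    qed
  qed (use C(1) fm in auto)
  also have "(\<Sum>x\<in>C. measure lborel (ball x \<epsilon>)) = real (card C) * (\<epsilon> ^ DIM('a) * ?c)"
    using content_ball_conv_unit_ball[of \<epsilon>, where ?'a = 'a] \<open>0 < \<epsilon>\<close> by simp
  also have "measure lborel (ball (0::'a) (R + 1)) = (R + 1) ^ DIM('a) * ?c"
    using content_ball_conv_unit_ball[of "R + 1" "0::'a"] \<open>0 < R\<close> by simp
  finally have "real (card C) * \<epsilon> ^ DIM('a) \<le> (R + 1) ^ DIM('a)"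
    using c by (simp add: mult.assoc[symmetric])
  then show ?thesis
    using \<open>0 < \<epsilon>\<close> by (simp add: power_divide field_simps)
qed

text \<open>The volume bound makes the set of admissible cardinalities finite. Only then is the
  \<open>Max\<close> in \<open>packing_number\<close> attained, and it agrees with the supremum
  because \<open>ln\<close> is monotone on cardinalities.\<close>

lemma packing_rate_eq:
  fixes E :: "'a::euclidean_space set"
  assumes "bounded E" "0 < \<epsilon>" "\<epsilon> < 1"
  shows "packing_rate E \<epsilon> = ereal (ln (real (packing_number E \<epsilon>)) / ln (inverse \<epsilon>))"
proof -
  obtain R where R: "0 < R" "E \<subseteq> ball 0 R"
    using bounded_subset_ballD[OF \<open>bounded E\<close>] by blast
  let ?S = "{card C |C. finite C \<and> C \<subseteq> E \<and> disjoint_family_on (\<lambda>x. ball x \<epsilon>) C}"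
  have sep: "disjoint_family_on (\<lambda>x. ball x \<epsilon>) C \<longleftrightarrow> separated (2 * \<epsilon>) C" for C :: "'a set"
    unfolding disjoint_family_on_def separated_def pairwise_def
    using \<open>0 < \<epsilon>\<close> by (auto simp: disjoint_balls_iff)
  have "?S \<subseteq> {..nat \<lfloor>((R + 1) / \<epsilon>) ^ DIM('a)\<rfloor>}"
  proof safe
    fix C assume "finite C" "C \<subseteq> E" "disjoint_family_on (\<lambda>x. ball x \<epsilon>) C"
    then have "real (card C) \<le> ((R + 1) / \<epsilon>) ^ DIM('a)"
      using R assms by (intro card_separated_le) (auto simp: sep)
    then show "card C \<le> nat \<lfloor>((R + 1) / \<epsilon>) ^ DIM('a)\<rfloor>" by (simp add: le_nat_floor)
  qed
  then have fin: "finite ?S" by (rule finite_subset) simp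
  have ne: "?S \<noteq> {}" by (auto intro!: exI[of _ "{}"] simp: disjoint_family_on_def)
  have l: "0 < ln (inverse \<epsilon>)" using assms by (intro ln_inverse_pos)
  obtain C where C: "finite C" "C \<subseteq> E" "disjoint_family_on (\<lambda>x. ball x \<epsilon>) C" "packing_number E \<epsilon> = card C"
    using Max_in[OF fin ne] unfolding packing_number_def[symmetric] by auto
  show ?thesis
  proof (rule antisym)
    show "packing_rate E \<epsilon> \<le> ereal (ln (real (packing_number E \<epsilon>)) / ln (inverse \<epsilon>))"
      unfolding packing_rate_def
    proof (rule SUP_least)
      fix D assume "D \<in> {C. finite C \<and> C \<subseteq> E \<and> separated (2 * \<epsilon>) C}"
      then have "card D \<in> ?S" using sep by auto
      then have "card D \<le> packing_number E \<epsilon>"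
        unfolding packing_number_def using fin by (rule Max_ge[rotated])
      then have "ln (real (card D)) \<le> ln (real (packing_number E \<epsilon>))"
        by (cases "card D = 0") auto
      then show "ereal (ln (real (card D)) / ln (inverse \<epsilon>)) \<le> ereal (ln (real (packing_number E \<epsilon>)) / ln (inverse \<epsilon>))"
        using l by (simp add: divide_right_mono del: ln_inverse)
    qed
    show "ereal (ln (real (packing_number E \<epsilon>)) / ln (inverse \<epsilon>)) \<le> packing_rate E \<epsilon>"
      unfolding packing_rate_def using C sep by (intro SUP_upper2[where i=C]) auto
  qed
qed

lemma minkowski_dim_eq_rate:
  fixes E :: "'a::euclidean_space set"
  assumes "bounded E"
  shows "upper_minkowski_dim E = upper_rate E" "lower_minkowski_dim E = lower_rate E"
proof -
  have "\<forall>\<^sub>F \<epsilon> in at_right 0. ereal (ln (real (packing_number E \<epsilon>)) / ln (inverse \<epsilon>)) = packing_rate E \<epsilon>"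
    using eventually_at_right_real[OF zero_less_one]
    by eventually_elim (use packing_rate_eq[OF assms] in auto)
  then show "upper_minkowski_dim E = upper_rate E" "lower_minkowski_dim E = lower_rate E"
    unfolding upper_minkowski_dim_def lower_minkowski_dim_def upper_rate_def lower_rate_def
    by (auto intro: Limsup_eq Liminf_eq)
qed

lemma rates_finite:
  fixes E :: "'a::euclidean_space set"
  assumes "bounded E"
  shows "\<bar>upper_rate E\<bar> \<noteq> \<infinity>" "\<bar>lower_rate E\<bar> \<noteq> \<infinity>"
proof -
  obtain R where R: "0 < R" "E \<subseteq> ball 0 R"
    using bounded_subset_ballD[OF \<open>bounded E\<close>] by blast
  let ?r = "\<lambda>\<epsilon>. ln (inverse (\<epsilon> / (R + 1))) / ln (inverse \<epsilon>)"
  \<comment> \<open>The limit is \<open>1\<close>; the bound \<open>2\<close> is a convenient larger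
    number, since only finiteness of the rates matters.\<close>
  have "\<forall>\<^sub>F \<epsilon> in at_right 0. ?r \<epsilon> < 2"
    using log_scale_tendsto_1[of "R + 1"] R by (intro order_tendstoD(2)) auto
  with eventually_at_right_real[OF zero_less_one]
  have "\<forall>\<^sub>F \<epsilon> in at_right 0. packing_rate E \<epsilon> \<le> ereal (2 * DIM('a))"
  proof eventually_elim
    case (elim \<epsilon>)
    then have l: "0 < ln (inverse \<epsilon>)" by (intro ln_inverse_pos) auto
    show ?case unfolding packing_rate_def
    proof (rule SUP_least)
      fix C assume C: "C \<in> {C. finite C \<and> C \<subseteq> E \<and> separated (2 * \<epsilon>) C}"
      have "ln (real (card C)) \<le> DIM('a) * ln (inverse (\<epsilon> / (R + 1)))"
      proof (cases "card C = 0")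
        case True
        then show ?thesis using elim R by (auto simp del: ln_inverse simp: field_simps)
      next
        case False
        then have "ln (real (card C)) \<le> ln (((R + 1) / \<epsilon>) ^ DIM('a))"
          using card_separated_le[of C R \<epsilon>] C R elim by (intro ln_mono) auto
        also have "\<dots> = DIM('a) * ln (inverse (\<epsilon> / (R + 1)))"
          using elim R by (simp add: ln_realpow del: ln_inverse)
        finally show ?thesis .
      qed
      then have "ln (real (card C)) / ln (inverse \<epsilon>) \<le> DIM('a) * ?r \<epsilon>"
        using l by (simp add: divide_right_mono del: ln_inverse)
      also have "\<dots> \<le> real DIM('a) * 2"
        using elim by (intro mult_left_mono) auto
      finally show "ereal (ln (real (card C)) / ln (inverse \<epsilon>)) \<le> ereal (2 * DIM('a))"
        by (simp add: mult.commute)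
    qed
  qed
  then have "upper_rate E \<le> ereal (2 * DIM('a))"
    unfolding upper_rate_def by (rule Limsup_bounded)
  moreover have "lower_rate E \<le> upper_rate E"
    unfolding lower_rate_def upper_rate_def by (rule Liminf_le_Limsup) simp
  moreover have "0 \<le> lower_rate E"
    unfolding lower_rate_def by (rule Liminf_bounded) (auto simp: packing_rate_nonneg)
  ultimately show "\<bar>upper_rate E\<bar> \<noteq> \<infinity>" "\<bar>lower_rate E\<bar> \<noteq> \<infinity>"
    by (cases "upper_rate E"; cases "lower_rate E"; auto)+
qed

section \<open>Graphs of functions\<close>

lemma countable_dense_subset:
  fixes E :: "'a::second_countable_topology set"
  obtains D where "countable D" "D \<subseteq> E" "E \<subseteq> closure D"
proof -
  obtain \<B> :: "'a set set" where \<B>: "countable \<B>" "topological_basis \<B>"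
    using ex_countable_basis by blast
  define D where "D = (\<lambda>U. SOME x. x \<in> U \<inter> E) ` {U\<in>\<B>. U \<inter> E \<noteq> {}}"
  have some: "(SOME x. x \<in> U \<inter> E) \<in> U \<inter> E" if "U \<inter> E \<noteq> {}" for U
  proof -
    from that have "\<exists>x. x \<in> U \<inter> E" by blast
    then show ?thesis by (rule someI_ex)
  qed
  show thesis
  proof
    show "countable D" unfolding D_def using \<B> by auto
    show "D \<subseteq> E" unfolding D_def using some by auto
    show "E \<subseteq> closure D"
    proof (intro subsetI closure_iff_nhds_not_empty[THEN iffD2] allI impI)
      fix x S V assume "x \<in> E" "V \<subseteq> S" "open V" "x \<in> V"
      then obtain U where U: "U \<in> \<B>" "x \<in> U" "U \<subseteq> V"
        using topological_basisE[OF \<B>(2)] by metis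
      then have "U \<inter> E \<noteq> {}" using \<open>x \<in> E\<close> by auto
      then have "(SOME x. x \<in> U \<inter> E) \<in> D \<inter> S"
        using some[of U] U \<open>V \<subseteq> S\<close> unfolding D_def by auto
      then show "D \<inter> S \<noteq> {}" by blast
    qed
  qed
qed

text \<open>
  A countable dense subset of the graph of \<open>f\<close> is mapped to a dense
  subset of the graph of \<open>b + f\<close> by the continuous map \<open>(t, x) \<mapsto> (t, b t + x)\<close>.
\<close>

lemma countable_graph_dense:
  fixes f :: "real \<Rightarrow> 'a::{real_normed_vector, second_countable_topology}"
  obtains A' where "countable A'" "A' \<subseteq> A"
    "\<And>b. continuous_on A b \<Longrightarrow> graph_over A (\<lambda>t. b t + f t) \<subseteq> closure (graph_over A' (\<lambda>t. b t + f t))"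
proof -
  obtain D where D: "countable D" "D \<subseteq> graph_over A f" "graph_over A f \<subseteq> closure D"
    by (rule countable_dense_subset)
  define A' where "A' = fst ` D"
  have "A' \<subseteq> A" using D by (auto simp: A'_def graph_over_def)
  have DA: "D = graph_over A' f"
    using D(2) by (force simp: A'_def graph_over_def)
  show thesis
  proof (rule that[of A'])
    show "countable A'" using D by (auto simp: A'_def)
    fix b :: "real \<Rightarrow> 'a" assume b: "continuous_on A b"
    let ?p = "\<lambda>z. (fst z, b (fst z) + snd z)"
    have c: "continuous_on (graph_over A f) ?p"
      by (intro continuous_intros continuous_on_compose2[OF b]) (auto simp: graph_over_def)
    show "graph_over A (\<lambda>t. b t + f t) \<subseteq> closure (graph_over A' (\<lambda>t. b t + f t))"
    proof
      fix z assume "z \<in> graph_over A (\<lambda>t. b t + f t)"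
      then obtain t where t: "t \<in> A" "z = ?p (t, f t)" by (auto simp: graph_over_def)
      have tin: "(t, f t) \<in> graph_over A f" using t by (auto simp: graph_over_def)
      then obtain u where u: "\<And>n. u n \<in> D" "u \<longlonglongrightarrow> (t, f t)"
        using D(3) closure_sequential by (metis subsetD)
      have "(\<lambda>n. ?p (u n)) \<longlonglongrightarrow> ?p (t, f t)"
        by (rule continuous_on_tendsto_compose[OF c u(2) tin]) (use subsetD[OF D(2) u(1)] in simp)
      moreover have "?p (u n) \<in> graph_over A' (\<lambda>t. b t + f t)" for n
        using u(1)[of n] DA by (auto simp: graph_over_def)
      ultimately show "z \<in> closure (graph_over A' (\<lambda>t. b t + f t))"
        unfolding closure_sequential t(2) by (intro exI[of _ "\<lambda>n. ?p (u n)"]) auto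
    qed
  qed fact
qed

text \<open>The right limit, the left limit and the single value at \<open>t\<close> bound
  \<open>f\<close> near each \<open>t\<close>; at an endpoint one side contains no points of the
  interval. Compactness passes to finitely many neighbourhoods.\<close>

lemma cadlag_on_bounded:
  fixes f :: "real \<Rightarrow> 'a::real_normed_vector"
  assumes "cadlag_on a b f"
  shows "bounded (f ` {a..b})"
proof -
  have loc: "\<exists>U. open U \<and> t \<in> U \<and> bounded (f ` (U \<inter> {a..b}))" if t: "t \<in> {a..b}" for t
  proof -
    have R: "\<exists>d>t. bounded (f ` ({t<..<d} \<inter> {a..b}))"
    proof (cases "t < b")
      case True
      then have "(f \<longlongrightarrow> f t) (at_right t)" using assms t by (auto simp: cadlag_on_def)
      then have "\<forall>\<^sub>F x in at_right t. dist (f x) (f t) < 1" by (rule tendstoD) simp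
      then obtain d where "t < d" "\<forall>x>t. x < d \<longrightarrow> dist (f x) (f t) < 1"
        by (auto simp: eventually_at_right_field)
      then show ?thesis
        by (intro exI[of _ d] conjI bounded_subset[OF bounded_ball[of "f t" 1]]) (auto simp: dist_commute)
    next
      case False
      then have "{t<..<t + 1} \<inter> {a..b} = {}" using t by auto
      then show ?thesis by (intro exI[of _ "t + 1"]) (simp only: image_empty, simp)
    qed
    have L: "\<exists>c<t. bounded (f ` ({c<..<t} \<inter> {a..b}))"
    proof (cases "a < t")
      case True
      then have "t \<in> {a<..b}" using t by simp
      then obtain l where "(f \<longlongrightarrow> l) (at_left t)" using assms unfolding cadlag_on_def by blast
      then have "\<forall>\<^sub>F x in at_left t. dist (f x) l < 1" by (rule tendstoD) simp
      then obtain d where "d < t" "\<forall>x>d. x < t \<longrightarrow> dist (f x) l < 1"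
        by (auto simp: eventually_at_left_field)
      then show ?thesis
        by (intro exI[of _ d] conjI bounded_subset[OF bounded_ball[of l 1]]) (auto simp: dist_commute)
    next
      case False
      then have "{t - 1<..<t} \<inter> {a..b} = {}" using t by auto
      then show ?thesis by (intro exI[of _ "t - 1"]) (simp only: image_empty, simp)
    qed
    from R L obtain c d where cd: "c < t" "t < d" "bounded (f ` ({c<..<t} \<inter> {a..b}))"
      "bounded (f ` ({t<..<d} \<inter> {a..b}))" by blast
    then have "bounded (f ` ({c<..<t} \<inter> {a..b}) \<union> {f t} \<union> f ` ({t<..<d} \<inter> {a..b}))" by simp
    then have "bounded (f ` ({c<..<d} \<inter> {a..b}))"
    proof (rule bounded_subset)
      show "f ` ({c<..<d} \<inter> {a..b}) \<subseteq> f ` ({c<..<t} \<inter> {a..b}) \<union> {f t} \<union> f ` ({t<..<d} \<inter> {a..b})"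
      proof (rule image_subsetI)
        fix x assume "x \<in> {c<..<d} \<inter> {a..b}"
        then show "f x \<in> f ` ({c<..<t} \<inter> {a..b}) \<union> {f t} \<union> f ` ({t<..<d} \<inter> {a..b})"
          by (cases x t rule: linorder_cases) auto
      qed
    qed
    with cd show ?thesis by (intro exI[of _ "{c<..<d}"]) auto
  qed
  then obtain U where U: "\<And>t. t \<in> {a..b} \<Longrightarrow> open (U t) \<and> t \<in> U t \<and> bounded (f ` (U t \<inter> {a..b}))"
    by metis
  obtain T where T: "T \<subseteq> {a..b}" "finite T" "{a..b} \<subseteq> (\<Union>t\<in>T. U t)"
    by (rule compactE_image[of "{a..b}" "{a..b}" U]) (use U in auto)
  have "bounded (\<Union>t\<in>T. f ` (U t \<inter> {a..b}))"
    using T U by (intro bounded_UN) auto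
  then show ?thesis
    by (rule bounded_subset) (use T in blast)
qed

lemma bounded_graph_over:
  assumes "bounded A" "bounded (h ` A)"
  shows "bounded (graph_over A h)"
  by (rule bounded_subset[OF bounded_Times[OF assms]]) (auto simp: graph_over_def)

section \<open>Dyadic interpolation\<close>

definition hat :: "real \<Rightarrow> real" where
  "hat x = max 0 (1 - \<bar>x\<bar>)"

text \<open>
  Meant for \<open>t \<in> [0, 1]\<close>; the node \<open>k = 2 ^ m + 1\<close> outside the unit interval has weight \<open>0\<close> there and
  only avoids a case distinction at \<open>t = 1\<close>.
\<close>

definition dyadic_interp :: "nat \<Rightarrow> (real \<Rightarrow> 'a::real_vector) \<Rightarrow> real \<Rightarrow> 'a" where
  "dyadic_interp m b t = (\<Sum>k\<le>2 ^ m + 1. hat (2 ^ m * t - real k) *\<^sub>R b (real k / 2 ^ m))"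

text \<open>A finite sum of tent functions of slope at most \<open>2 ^ m\<close>. The constant
  depends on \<open>b\<close>, which is harmless because it is used for one path at a time.\<close>

lemma dyadic_interp_lipschitz:
  fixes b :: "real \<Rightarrow> 'a::real_normed_vector"
  shows "\<exists>K. K-lipschitz_on S (dyadic_interp m b)"
proof -
  have "(2 ^ m * norm x)-lipschitz_on S (\<lambda>t. hat (2 ^ m * t - r) *\<^sub>R x)" for r and x :: 'a
  proof (rule lipschitz_onI)
    fix s t
    have "\<bar>hat (2 ^ m * s - r) - hat (2 ^ m * t - r)\<bar> \<le> \<bar>2 ^ m * s - 2 ^ m * t\<bar>"
      unfolding hat_def by linarith
    also have "\<dots> = 2 ^ m * \<bar>s - t\<bar>"
      by (simp add: abs_mult flip: right_diff_distrib)
    finally have "\<bar>hat (2 ^ m * s - r) - hat (2 ^ m * t - r)\<bar> * norm x \<le> 2 ^ m * \<bar>s - t\<bar> * norm x"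
      by (rule mult_right_mono) simp
    then show "dist (hat (2 ^ m * s - r) *\<^sub>R x) (hat (2 ^ m * t - r) *\<^sub>R x) \<le> 2 ^ m * norm x * dist s t"
      by (simp add: dist_norm mult_ac flip: scaleR_left_diff_distrib)
  qed simp
  note * = this
  have "(\<Sum>k\<in>I. 2 ^ m * norm (b (real k / 2 ^ m)))-lipschitz_on S
    (\<lambda>t. \<Sum>k\<in>I. hat (2 ^ m * t - real k) *\<^sub>R b (real k / 2 ^ m))" if "finite I" for I
    using that by induction (auto intro!: lipschitz_intros *)
  then show ?thesis
    unfolding dyadic_interp_def[abs_def] by blast
qed

text \<open>At most the two tents at the ends of a cell are nonzero there. Both ends of the cell are
  allowed, so \<open>j\<close> need not be the floor of \<open>2 ^ m * t\<close>, and
  \<open>t = 1\<close> is covered by the extra node.\<close>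

lemma dyadic_interp_eq:
  fixes b :: "real \<Rightarrow> 'a::real_vector"
  assumes "0 \<le> t" "t \<le> 1" and j: "real j \<le> 2 ^ m * t" "2 ^ m * t \<le> real j + 1"
  shows "dyadic_interp m b t = (1 - (2 ^ m * t - real j)) *\<^sub>R b (real j / 2 ^ m)
    + (2 ^ m * t - real j) *\<^sub>R b ((real j + 1) / 2 ^ m)"
proof -
  have "2 ^ m * t \<le> 2 ^ m * 1"
    using assms by (intro mult_left_mono) auto
  with j(1) have "real j \<le> 2 ^ m" by linarith
  then have "j \<le> 2 ^ m" using of_nat_le_iff[where 'a=real, of j "2 ^ m"] by simp
  then have "dyadic_interp m b t = (\<Sum>k\<in>{j, Suc j}. hat (2 ^ m * t - real k) *\<^sub>R b (real k / 2 ^ m))"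
    unfolding dyadic_interp_def
  proof (intro sum.mono_neutral_right ballI)
    fix k assume "k \<in> {..2 ^ m + 1} - {j, Suc j}"
    then have "k < j \<or> Suc j < k" by auto
    then have "real k + 1 \<le> real j \<or> real j + 2 \<le> real k" by linarith
    then have "hat (2 ^ m * t - real k) = 0" using j unfolding hat_def by linarith
    then show "hat (2 ^ m * t - real k) *\<^sub>R b (real k / 2 ^ m) = 0" by simp
  qed auto
  also have "\<dots> = hat (2 ^ m * t - real j) *\<^sub>R b (real j / 2 ^ m) + hat (2 ^ m * t - (real j + 1)) *\<^sub>R b ((real j + 1) / 2 ^ m)"
    by (simp add: add.commute)
  also have "hat (2 ^ m * t - real j) = 1 - (2 ^ m * t - real j)"
    using j unfolding hat_def by linarith
  also have "hat (2 ^ m * t - (real j + 1)) = 2 ^ m * t - real j"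
    using j unfolding hat_def by linarith
  finally show ?thesis .
qed

definition dyadic_incr :: "(real \<Rightarrow> 'a::real_vector) \<Rightarrow> nat \<Rightarrow> nat \<Rightarrow> 'a" where
  "dyadic_incr b m k = b ((real k + 1) / 2 ^ m) - b (real k / 2 ^ m)"

text \<open>Twice the midpoint value minus the two end values on the \<open>k\<close>-th cell of
  level \<open>m\<close>: up to normalisation, the coefficient of \<open>b\<close> at a Schauder
  function. It is written through two increments of level \<open>Suc m\<close> so that it has the
  form \<open>X - Y\<close> of independent variables.\<close>

definition dyadic_diff :: "(real \<Rightarrow> 'a::real_vector) \<Rightarrow> nat \<Rightarrow> nat \<Rightarrow> 'a" where
  "dyadic_diff b m k = dyadic_incr b (Suc m) (2 * k) - dyadic_incr b (Suc m) (2 * k + 1)"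

lemma dyadic_incr_split:
  "dyadic_incr b m k = dyadic_incr b (Suc m) (2 * k) + dyadic_incr b (Suc m) (2 * k + 1)"
proof -
  have "(2 * real k + 2) / (2 * 2 ^ m) = (real k + 1) / 2 ^ m" "2 * real k / (2 * 2 ^ m) = real k / 2 ^ m"
    by (simp_all add: field_simps)
  then show ?thesis by (simp add: dyadic_incr_def add.commute)
qed

text \<open>On a cell of level \<open>m\<close> the two interpolations differ by a tent over the
  midpoint, whose height is proportional to the second difference there. The numbers
  \<open>c\<close> and \<open>k\<close> depend on \<open>t\<close> and \<open>m\<close> but not on
  \<open>b\<close>, so they are deterministic for a random path.\<close>

lemma dyadic_interp_Suc:
  assumes "0 \<le> t" "t \<le> 1"
  obtains c k where "\<And>b :: real \<Rightarrow> 'a::real_vector.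
    dyadic_interp (Suc m) b t - dyadic_interp m b t = c *\<^sub>R dyadic_diff b m k"
proof -
  define j where "j = nat \<lfloor>2 ^ m * t\<rfloor>"
  define x where "x = 2 ^ m * t - real j"
  have "0 \<le> 2 ^ m * t" using assms by simp
  then have jx: "real j \<le> 2 ^ m * t" "2 ^ m * t \<le> real j + 1"
    unfolding j_def by linarith+
  have q: "2 * real j / (2 * 2 ^ m) = real j / 2 ^ m" "(2 * real j + 2) / (2 * 2 ^ m) = (real j + 1) / 2 ^ m"
    by (simp_all add: field_simps)
  define y where "y = (2 * real j + 1) / (2 * 2 ^ m)"
  have z: "dyadic_diff b m j = b y + b y - b (real j / 2 ^ m) - b ((real j + 1) / 2 ^ m)" for b :: "real \<Rightarrow> 'a"
    using q unfolding dyadic_diff_def dyadic_incr_def by (simp add: y_def add_ac)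
  note I = dyadic_interp_eq[OF assms jx, folded x_def]
  show thesis
  proof (cases "x \<le> 1 / 2")
    case True
    then have "real (2 * j) \<le> 2 ^ Suc m * t" "2 ^ Suc m * t \<le> real (2 * j) + 1"
      using jx by (auto simp: x_def)
    note J = dyadic_interp_eq[OF assms this]
    have e: "2 ^ Suc m * t - real (2 * j) = x + x" by (simp add: x_def)
    have f: "real (2 * j) / 2 ^ Suc m = real j / 2 ^ m" "(real (2 * j) + 1) / 2 ^ Suc m = y"
      using q by (simp_all add: y_def)
    have "dyadic_interp (Suc m) b t - dyadic_interp m b t = x *\<^sub>R dyadic_diff b m j" for b :: "real \<Rightarrow> 'a"
      unfolding I J e f z
      by (simp only: scaleR_left_distrib scaleR_left_diff_distrib scaleR_right_distrib scaleR_right_diff_distrib scaleR_one)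
        (simp add: add_ac diff_add_eq add_diff_eq diff_diff_eq2 diff_diff_eq)
    then show thesis by (rule that)
  next
    case False
    then have "real (2 * j + 1) \<le> 2 ^ Suc m * t" "2 ^ Suc m * t \<le> real (2 * j + 1) + 1"
      using jx by (auto simp: x_def)
    note J = dyadic_interp_eq[OF assms this]
    have e: "2 ^ Suc m * t - real (2 * j + 1) = x + x - 1" by (simp add: x_def)
    have f: "real (2 * j + 1) / 2 ^ Suc m = y" "(real (2 * j + 1) + 1) / 2 ^ Suc m = (real j + 1) / 2 ^ m"
      using q by (simp_all add: y_def add_ac)
    have "dyadic_interp (Suc m) b t - dyadic_interp m b t = (1 - x) *\<^sub>R dyadic_diff b m j" for b :: "real \<Rightarrow> 'a"
      unfolding I J e f z
      by (simp only: scaleR_left_distrib scaleR_left_diff_distrib scaleR_right_distrib scaleR_right_diff_distrib scaleR_one)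
        (simp add: add_ac diff_add_eq add_diff_eq diff_diff_eq2 diff_diff_eq)
    then show thesis by (rule that)
  qed
qed

lemma dyadic_interp_tendsto:
  fixes b :: "real \<Rightarrow> 'a::real_normed_vector"
  assumes "continuous_on {0..} b" "0 \<le> t" "t \<le> 1"
  shows "(\<lambda>N. dyadic_interp N b t) \<longlonglongrightarrow> b t"
proof -
  define j where "j N = nat \<lfloor>2 ^ N * t\<rfloor>" for N :: nat
  define x where "x N = 2 ^ N * t - real (j N)" for N
  have jx: "real (j N) \<le> 2 ^ N * t" "2 ^ N * t \<le> real (j N) + 1" for N
  proof -
    have "0 \<le> 2 ^ N * t" using assms by simp
    then show "real (j N) \<le> 2 ^ N * t" "2 ^ N * t \<le> real (j N) + 1"
      unfolding j_def by linarith+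
  qed
  have x: "0 \<le> x N" "x N \<le> 1" for N using jx[of N] by (auto simp: x_def)
  have p: "(\<lambda>N. (1/2::real) ^ N) \<longlonglongrightarrow> 0" by (rule LIMSEQ_power_zero) simp
  have "(\<lambda>N. t - x N * (1/2) ^ N) \<longlonglongrightarrow> t"
  proof -
    have "(\<lambda>N. x N * (1/2) ^ N) \<longlonglongrightarrow> 0"
      by (rule tendsto_sandwich[OF _ _ tendsto_const p]) (use x in \<open>auto intro!: mult_left_le_one_le\<close>)
    from tendsto_diff[OF tendsto_const this, of t] show ?thesis by simp
  qed
  moreover have "t - x N * (1/2) ^ N = real (j N) / 2 ^ N" for N
    by (simp add: x_def field_simps power_divide)
  ultimately have lo: "(\<lambda>N. real (j N) / 2 ^ N) \<longlonglongrightarrow> t" by simp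
  have "(real (j N) + 1) / 2 ^ N = real (j N) / 2 ^ N + (1/2) ^ N" for N
    by (simp add: field_simps power_divide)
  with tendsto_add[OF lo p] have hi: "(\<lambda>N. (real (j N) + 1) / 2 ^ N) \<longlonglongrightarrow> t" by simp
  note c = continuous_on_tendsto_compose[OF assms(1)]
  have blo: "(\<lambda>N. b (real (j N) / 2 ^ N)) \<longlonglongrightarrow> b t"
    by (rule c[OF lo]) (use assms in auto)
  \<comment> \<open>For \<open>t = 1\<close> this node lies beyond \<open>1\<close>, so continuity
    on \<open>{0..}\<close> is used here.\<close>
  have bhi: "(\<lambda>N. b ((real (j N) + 1) / 2 ^ N)) \<longlonglongrightarrow> b t"
    by (rule c[OF hi]) (use assms in auto)
  have "(\<lambda>N. x N *\<^sub>R (b ((real (j N) + 1) / 2 ^ N) - b (real (j N) / 2 ^ N))) \<longlonglongrightarrow> 0"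
  proof (rule Lim_null_comparison)
    show "\<forall>\<^sub>F N in sequentially. norm (x N *\<^sub>R (b ((real (j N) + 1) / 2 ^ N) - b (real (j N) / 2 ^ N)))
      \<le> norm (b ((real (j N) + 1) / 2 ^ N) - b (real (j N) / 2 ^ N))"
      using x by (intro always_eventually allI) (simp add: mult_left_le_one_le)
    show "(\<lambda>N. norm (b ((real (j N) + 1) / 2 ^ N) - b (real (j N) / 2 ^ N))) \<longlonglongrightarrow> 0"
      using tendsto_norm[OF tendsto_diff[OF bhi blo]] by simp
  qed
  from tendsto_add[OF blo this]
  have "(\<lambda>N. b (real (j N) / 2 ^ N) + x N *\<^sub>R (b ((real (j N) + 1) / 2 ^ N) - b (real (j N) / 2 ^ N))) \<longlonglongrightarrow> b t"
    by simp
  moreover have "dyadic_interp N b t = b (real (j N) / 2 ^ N) + x N *\<^sub>R (b ((real (j N) + 1) / 2 ^ N) - b (real (j N) / 2 ^ N))" for N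
    unfolding dyadic_interp_eq[OF assms(2,3) jx, folded x_def] by (simp add: algebra_simps)
  ultimately show ?thesis by simp
qed

section \<open>Measurability of the packing rates of a random graph\<close>

text \<open>The assumption says that any level exceeded by \<open>\<phi>\<close> at some radius
  below \<open>b\<close> is also exceeded at a rational radius below \<open>b\<close>. Suprema over
  rational radii then suffice, and the upper limit becomes a countable expression.\<close>

lemma Limsup_at_right_rat:
  fixes \<phi> :: "real \<Rightarrow> 'a::{complete_linorder, dense_linorder}"
  assumes "\<And>\<epsilon> b c. 0 < \<epsilon> \<Longrightarrow> \<epsilon> < b \<Longrightarrow> b < 1 \<Longrightarrow> c < \<phi> \<epsilon> \<Longrightarrow> \<exists>e\<in>\<rat> \<inter> {0<..<b}. c < \<phi> e"
  shows "Limsup (at_right 0) \<phi> = (INF b\<in>\<rat> \<inter> {0<..<1}. SUP e\<in>\<rat> \<inter> {0<..<b}. \<phi> e)"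
proof (rule antisym)
  show "Limsup (at_right 0) \<phi> \<le> (INF b\<in>\<rat> \<inter> {0<..<1}. SUP e\<in>\<rat> \<inter> {0<..<b}. \<phi> e)"
  proof (rule INF_greatest)
    fix b :: real assume b: "b \<in> \<rat> \<inter> {0<..<1}"
    show "Limsup (at_right 0) \<phi> \<le> (SUP e\<in>\<rat> \<inter> {0<..<b}. \<phi> e)"
    proof (rule Limsup_bounded)
      have "\<forall>\<^sub>F \<epsilon> in at_right 0. \<epsilon> \<in> {0<..<b}" using b by (intro eventually_at_right_real) auto
      then show "\<forall>\<^sub>F \<epsilon> in at_right 0. \<phi> \<epsilon> \<le> (SUP e\<in>\<rat> \<inter> {0<..<b}. \<phi> e)"
      proof eventually_elim
        case (elim \<epsilon>)
        show ?case
        proof (rule ccontr)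
          assume "\<not> ?thesis"
          then have "\<exists>e\<in>\<rat> \<inter> {0<..<b}. (SUP e\<in>\<rat> \<inter> {0<..<b}. \<phi> e) < \<phi> e"
            using elim b by (intro assms[of \<epsilon> b]) (simp_all add: not_le)
          then show False using SUP_upper[of _ "\<rat> \<inter> {0<..<b}" \<phi>] by (meson not_le)
        qed
      qed
    qed
  qed
  show "(INF b\<in>\<rat> \<inter> {0<..<1}. SUP e\<in>\<rat> \<inter> {0<..<b}. \<phi> e) \<le> Limsup (at_right 0) \<phi>"
  proof (rule dense_ge)
    fix y assume "Limsup (at_right 0) \<phi> < y"
    then have "\<forall>\<^sub>F \<epsilon> in at_right 0. \<phi> \<epsilon> < y" by (rule Limsup_lessD)
    then obtain d where d: "0 < d" "\<And>\<epsilon>. 0 < \<epsilon> \<Longrightarrow> \<epsilon> < d \<Longrightarrow> \<phi> \<epsilon> < y"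
      by (auto simp: eventually_at_right_field)
    obtain b where "b \<in> \<rat>" "0 < b" "b < min d 1"
      using Rats_dense_in_real[of 0 "min d 1"] d(1) by (metis min_less_iff_conj zero_less_one)
    then show "(INF b\<in>\<rat> \<inter> {0<..<1}. SUP e\<in>\<rat> \<inter> {0<..<b}. \<phi> e) \<le> y"
      by (intro INF_lower2[of b] SUP_least less_imp_le[OF d(2)]) simp_all
  qed
qed

text \<open>The identity map with scale \<open>L = \<epsilon>' / \<epsilon>\<close>: a smaller
  radius admits more families. This one-sided bound replaces continuity in the radius, which can
  fail.\<close>

lemma packing_rate_times:
  assumes "0 < \<epsilon>" "\<epsilon> \<le> \<epsilon>'" "\<epsilon>' < 1"
  shows "packing_rate E \<epsilon>' \<le> ereal (ln (inverse \<epsilon>) / ln (inverse \<epsilon>')) * packing_rate E \<epsilon>"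
proof -
  have "packing_rate E \<epsilon>' \<le> ereal (ln (inverse (\<epsilon>' / (\<epsilon>' / \<epsilon>))) / ln (inverse \<epsilon>')) * packing_rate E (\<epsilon>' / (\<epsilon>' / \<epsilon>))"
    using assms by (intro packing_rate_scale[where p="\<lambda>x. x"]) (auto simp: field_simps)
  moreover have "\<epsilon>' / (\<epsilon>' / \<epsilon>) = \<epsilon>" using assms by simp
  ultimately show ?thesis by simp
qed

lemma log_ratio_tendsto:
  fixes \<epsilon> :: real
  assumes "0 < \<epsilon>" "\<epsilon> < 1"
  shows "((\<lambda>e. ln (inverse e) / ln (inverse \<epsilon>)) \<longlongrightarrow> 1) (at \<epsilon> within S)"
    "((\<lambda>e. ln (inverse \<epsilon>) / ln (inverse e)) \<longlongrightarrow> 1) (at \<epsilon> within S)"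
proof -
  have l: "ln (inverse \<epsilon>) \<noteq> 0" using ln_inverse_pos[OF assms] by simp
  have "((\<lambda>e. ln (inverse e) / ln (inverse \<epsilon>)) \<longlongrightarrow> ln (inverse \<epsilon>) / ln (inverse \<epsilon>)) (at \<epsilon> within S)"
    "((\<lambda>e. ln (inverse \<epsilon>) / ln (inverse e)) \<longlongrightarrow> ln (inverse \<epsilon>) / ln (inverse \<epsilon>)) (at \<epsilon> within S)"
    by (intro tendsto_divide tendsto_const tendsto_ln tendsto_inverse tendsto_ident_at l; use assms in simp)+
  then show "((\<lambda>e. ln (inverse e) / ln (inverse \<epsilon>)) \<longlongrightarrow> 1) (at \<epsilon> within S)"
    "((\<lambda>e. ln (inverse \<epsilon>) / ln (inverse e)) \<longlongrightarrow> 1) (at \<epsilon> within S)"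
    unfolding divide_self[OF l] .
qed

text \<open>A family that is separated for \<open>\<epsilon>\<close> stays separated for smaller
  \<open>e\<close>, and the normalising logarithm is continuous, so a rational slightly to the left
  of \<open>\<epsilon>\<close> works.\<close>

lemma packing_rate_rat_above:
  assumes "0 < \<epsilon>" "\<epsilon> < b" "b < 1" "c < packing_rate E \<epsilon>"
  shows "\<exists>e\<in>\<rat> \<inter> {0<..<b}. c < packing_rate E e"
proof -
  obtain C where C: "finite C" "C \<subseteq> E" "separated (2 * \<epsilon>) C"
    "c < ereal (ln (real (card C)) / ln (inverse \<epsilon>))"
    using assms(4) unfolding packing_rate_def less_SUP_iff by blast
  have "((\<lambda>e. ereal (ln (real (card C)) / ln (inverse \<epsilon>) * (ln (inverse \<epsilon>) / ln (inverse e)))) \<longlongrightarrow>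
    ereal (ln (real (card C)) / ln (inverse \<epsilon>) * 1)) (at_left \<epsilon>)"
    using assms by (intro lim_ereal[THEN iffD2] tendsto_mult tendsto_const log_ratio_tendsto) auto
  then have "\<forall>\<^sub>F e in at_left \<epsilon>. c < ereal (ln (real (card C)) / ln (inverse \<epsilon>) * (ln (inverse \<epsilon>) / ln (inverse e)))"
    by (rule order_tendstoD) (use C in simp)
  then obtain d where d: "d < \<epsilon>"
    "\<And>e. d < e \<Longrightarrow> e < \<epsilon> \<Longrightarrow> c < ereal (ln (real (card C)) / ln (inverse \<epsilon>) * (ln (inverse \<epsilon>) / ln (inverse e)))"
    by (auto simp: eventually_at_left_field)
  obtain e where e: "e \<in> \<rat>" "max d 0 < e" "e < \<epsilon>"
    using Rats_dense_in_real[of "max d 0" \<epsilon>] d(1) assms(1) by (metis max_less_iff_conj)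
  have "0 < ln (inverse \<epsilon>)" using assms by (intro ln_inverse_pos) auto
  then have "c < ereal (ln (real (card C)) / ln (inverse e))"
    using d(2)[of e] e assms by (simp del: ln_inverse)
  also have "\<dots> \<le> packing_rate E e"
    unfolding packing_rate_def using C e
    by (intro SUP_upper) (auto elim: separated_mono)
  finally show ?thesis using e assms by (intro bexI[of _ e]) auto
qed

text \<open>Here the rational lies slightly to the right of \<open>\<epsilon>\<close>, where
  \<open>packing_rate_times\<close> bounds the rate by a factor close to \<open>1\<close>.\<close>

lemma packing_rate_rat_below:
  assumes "0 < \<epsilon>" "\<epsilon> < b" "b < 1" "packing_rate E \<epsilon> < c"
  shows "\<exists>e\<in>\<rat> \<inter> {0<..<b}. packing_rate E e < c"
proof -
  obtain r where r: "packing_rate E \<epsilon> = ereal r"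
    using assms(4) packing_rate_nonneg[of E \<epsilon>] by (cases "packing_rate E \<epsilon>") auto
  have "((\<lambda>e. ereal (ln (inverse \<epsilon>) / ln (inverse e) * r)) \<longlongrightarrow> ereal (1 * r)) (at_right \<epsilon>)"
    using assms by (intro lim_ereal[THEN iffD2] tendsto_mult tendsto_const log_ratio_tendsto) auto
  then have "\<forall>\<^sub>F e in at_right \<epsilon>. ereal (ln (inverse \<epsilon>) / ln (inverse e) * r) < c"
    by (rule order_tendstoD) (use r assms in simp)
  then obtain d where d: "\<epsilon> < d"
    "\<And>e. \<epsilon> < e \<Longrightarrow> e < d \<Longrightarrow> ereal (ln (inverse \<epsilon>) / ln (inverse e) * r) < c"
    by (auto simp: eventually_at_right_field)
  obtain e where e: "e \<in> \<rat>" "\<epsilon> < e" "e < min d b"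
    using Rats_dense_in_real[of \<epsilon> "min d b"] d(1) assms(2) by (metis min_less_iff_conj)
  have "packing_rate E e \<le> ereal (ln (inverse \<epsilon>) / ln (inverse e)) * packing_rate E \<epsilon>"
    using e assms by (intro packing_rate_times) auto
  also have "\<dots> < c" using d(2)[of e] e r by (simp del: ln_inverse)
  finally show ?thesis using e assms by (intro bexI[of _ e]) auto
qed

lemma upper_rate_rat:
  "upper_rate E = (INF b\<in>\<rat> \<inter> {0<..<1}. SUP e\<in>\<rat> \<inter> {0<..<b}. packing_rate E e)"
  unfolding upper_rate_def by (intro Limsup_at_right_rat packing_rate_rat_above)

lemma lower_rate_rat:
  "lower_rate E = (SUP b\<in>\<rat> \<inter> {0<..<1}. INF e\<in>\<rat> \<inter> {0<..<b}. packing_rate E e)"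
proof -
  \<comment> \<open>The lower limit is treated as an upper limit of the negated rate.\<close>
  have "Limsup (at_right 0) (\<lambda>\<epsilon>. - packing_rate E \<epsilon>)
    = (INF b\<in>\<rat> \<inter> {0<..<1}. SUP e\<in>\<rat> \<inter> {0<..<b}. - packing_rate E e)"
  proof (rule Limsup_at_right_rat)
    fix \<epsilon> b :: real and c assume *: "0 < \<epsilon>" "\<epsilon> < b" "b < 1" "c < - packing_rate E \<epsilon>"
    then have "packing_rate E \<epsilon> < - c" by (metis ereal_less_uminus_reorder)
    from packing_rate_rat_below[OF *(1-3) this] show "\<exists>e\<in>\<rat> \<inter> {0<..<b}. c < - packing_rate E e"
      by (metis ereal_less_uminus_reorder)
  qed
  then show ?thesis
    unfolding lower_rate_def by (simp add: ereal_Limsup_uminus ereal_SUP_uminus_eq ereal_INF_uminus_eq)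
qed

text \<open>Indexing by finite sets of times makes the index set independent of \<open>h\<close>,
  and countable for countable \<open>T\<close>. The default \<open>0\<close> does not affect the
  supremum because packing rates are nonnegative.\<close>

lemma packing_rate_graph_over:
  "packing_rate (graph_over T h) \<epsilon> = (SUP F\<in>{F. finite F \<and> F \<subseteq> T}.
     if \<forall>s\<in>F. \<forall>t\<in>F. s \<noteq> t \<longrightarrow> 2 * \<epsilon> \<le> dist (s, h s) (t, h t)
     then ereal (ln (real (card F)) / ln (inverse \<epsilon>)) else 0)"
  (is "?L = (SUP F\<in>?I. ?f F)")
proof (rule antisym)
  show "?L \<le> (SUP F\<in>?I. ?f F)"
    unfolding packing_rate_def
  proof (rule SUP_mono)
    fix C assume C: "C \<in> {C. finite C \<and> C \<subseteq> graph_over T h \<and> separated (2 * \<epsilon>) C}"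
    have "inj_on fst (graph_over T h)" by (auto simp: inj_on_def graph_over_def)
    then have inj: "inj_on fst C" using C by (auto intro: inj_on_subset)
    have "(s, h s) \<in> C" if "s \<in> fst ` C" for s
      using that C by (force simp: graph_over_def)
    then have "\<forall>s\<in>fst ` C. \<forall>t\<in>fst ` C. s \<noteq> t \<longrightarrow> 2 * \<epsilon> \<le> dist (s, h s) (t, h t)"
      using C unfolding separated_def pairwise_def by blast
    then have "ereal (ln (real (card C)) / ln (inverse \<epsilon>)) \<le> ?f (fst ` C)"
      using inj by (simp add: card_image)
    moreover have "fst ` C \<in> ?I" using C by (auto simp: graph_over_def)
    ultimately show "\<exists>F\<in>?I. ereal (ln (real (card C)) / ln (inverse \<epsilon>)) \<le> ?f F" by blast
  qed
  show "(SUP F\<in>?I. ?f F) \<le> ?L"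
  proof (rule SUP_least)
    fix F assume F: "F \<in> ?I"
    show "?f F \<le> ?L"
    proof (cases "\<forall>s\<in>F. \<forall>t\<in>F. s \<noteq> t \<longrightarrow> 2 * \<epsilon> \<le> dist (s, h s) (t, h t)")
      case True
      have "card ((\<lambda>t. (t, h t)) ` F) = card F" by (intro card_image inj_onI) auto
      moreover have "separated (2 * \<epsilon>) ((\<lambda>t. (t, h t)) ` F)"
        using True unfolding separated_def pairwise_def by auto
      ultimately have "ereal (ln (real (card F)) / ln (inverse \<epsilon>)) \<le> ?L"
        unfolding packing_rate_def using F
        by (intro SUP_upper2[of "(\<lambda>t. (t, h t)) ` F"]) (auto simp: graph_over_def)
      then show ?thesis using True by simp
    qed (use packing_rate_nonneg in auto)
  qed
qed

lemma measurable_packing_rate_graph: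
  fixes h :: "'w \<Rightarrow> real \<Rightarrow> 'a::{real_normed_vector, second_countable_topology}"
  assumes "countable T" "\<And>t. t \<in> T \<Longrightarrow> (\<lambda>\<omega>. h \<omega> t) \<in> borel_measurable N"
  shows "(\<lambda>\<omega>. packing_rate (graph_over T (h \<omega>)) \<epsilon>) \<in> borel_measurable N"
  unfolding packing_rate_graph_over
proof (intro borel_measurable_SUP)
  show "countable {F. finite F \<and> F \<subseteq> T}" using assms(1) by (rule countable_Collect_finite_subset)
  fix F assume "F \<in> {F. finite F \<and> F \<subseteq> T}"
  then have F: "finite F" "F \<subseteq> T" by auto
  have pair: "Measurable.pred N (\<lambda>\<omega>. s \<noteq> t \<longrightarrow> 2 * \<epsilon> \<le> dist (s, h \<omega> s) (t, h \<omega> t))"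
    if "s \<in> F" "t \<in> F" for s t
  proof -
    have [measurable]: "(\<lambda>\<omega>. h \<omega> s) \<in> borel_measurable N" "(\<lambda>\<omega>. h \<omega> t) \<in> borel_measurable N"
      using assms(2) F that by auto
    show ?thesis unfolding dist_Pair_Pair by measurable
  qed
  have "Measurable.pred N (\<lambda>\<omega>. \<forall>s\<in>F. \<forall>t\<in>F. s \<noteq> t \<longrightarrow> 2 * \<epsilon> \<le> dist (s, h \<omega> s) (t, h \<omega> t))"
    using F(1) pair by (intro pred_intros_finite)
  then show "(\<lambda>\<omega>. if \<forall>s\<in>F. \<forall>t\<in>F. s \<noteq> t \<longrightarrow> 2 * \<epsilon> \<le> dist (s, h \<omega> s) (t, h \<omega> t)
     then ereal (ln (real (card F)) / ln (inverse \<epsilon>)) else 0) \<in> borel_measurable N"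
    by (intro measurable_If measurable_const) (simp_all add: pred_def)
qed

lemma measurable_rates_graph:
  fixes h :: "'w \<Rightarrow> real \<Rightarrow> 'a::{real_normed_vector, second_countable_topology}"
  assumes "countable T" "\<And>t. t \<in> T \<Longrightarrow> (\<lambda>\<omega>. h \<omega> t) \<in> borel_measurable N"
  shows "(\<lambda>\<omega>. upper_rate (graph_over T (h \<omega>))) \<in> borel_measurable N"
    "(\<lambda>\<omega>. lower_rate (graph_over T (h \<omega>))) \<in> borel_measurable N"
  unfolding upper_rate_rat lower_rate_rat
  by (intro borel_measurable_SUP borel_measurable_INF measurable_packing_rate_graph assms
      countable_Int1 countable_rat; simp)+

section \<open>Sums and differences of independent Gaussian vectors\<close>

text \<open>The change of variables \<open>u = x + y\<close>, \<open>v = x - y\<close> with Jacobian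
  \<open>2 ^ DIM('a)\<close>, carried out one variable at a time: a translation in \<open>x\<close>,
  then the affine map from \<open>y\<close> to \<open>u - 2 *\<^sub>R y\<close>.\<close>

lemma nn_integral_sum_diff:
  fixes \<alpha> \<beta> :: "'a::euclidean_space \<Rightarrow> ennreal"
  assumes [measurable]: "\<alpha> \<in> borel_measurable borel" "\<beta> \<in> borel_measurable borel"
  shows "ennreal (2 ^ DIM('a)) * (\<integral>\<^sup>+x. \<integral>\<^sup>+y. \<alpha> (x + y) * \<beta> (x - y) \<partial>lborel \<partial>lborel)
    = (\<integral>\<^sup>+u. \<alpha> u \<partial>lborel) * (\<integral>\<^sup>+v. \<beta> v \<partial>lborel)"
proof -
  have "(\<integral>\<^sup>+x. \<integral>\<^sup>+y. \<alpha> (x + y) * \<beta> (x - y) \<partial>lborel \<partial>lborel)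
      = (\<integral>\<^sup>+y. \<integral>\<^sup>+x. \<alpha> (x + y) * \<beta> (x - y) \<partial>lborel \<partial>lborel)"
    by (rule lborel_pair.Fubini'[symmetric]) simp
  also have "\<dots> = (\<integral>\<^sup>+y. \<integral>\<^sup>+u. \<alpha> u * \<beta> (u - 2 *\<^sub>R y) \<partial>lborel \<partial>lborel)"
  proof (rule nn_integral_cong)
    fix y :: 'a
    have "(\<integral>\<^sup>+x. \<alpha> (x + y) * \<beta> (x - y) \<partial>lborel)
        = (\<integral>\<^sup>+x. \<alpha> (x + y) * \<beta> (x - y) \<partial>distr lborel borel ((+) (- y)))"
      by (simp only: lborel_distr_plus)
    also have "\<dots> = (\<integral>\<^sup>+u. \<alpha> u * \<beta> (u - 2 *\<^sub>R y) \<partial>lborel)"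
      by (subst nn_integral_distr) (auto simp: scaleR_2 algebra_simps)
    finally show "(\<integral>\<^sup>+x. \<alpha> (x + y) * \<beta> (x - y) \<partial>lborel) = (\<integral>\<^sup>+u. \<alpha> u * \<beta> (u - 2 *\<^sub>R y) \<partial>lborel)" .
  qed
  also have "\<dots> = (\<integral>\<^sup>+u. \<integral>\<^sup>+y. \<alpha> u * \<beta> (u - 2 *\<^sub>R y) \<partial>lborel \<partial>lborel)"
    by (rule lborel_pair.Fubini') simp
  also have "\<dots> = (\<integral>\<^sup>+u. \<alpha> u * (\<integral>\<^sup>+y. \<beta> (u - 2 *\<^sub>R y) \<partial>lborel) \<partial>lborel)"
    by (simp add: nn_integral_cmult)
  finally have *: "(\<integral>\<^sup>+x. \<integral>\<^sup>+y. \<alpha> (x + y) * \<beta> (x - y) \<partial>lborel \<partial>lborel)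
      = (\<integral>\<^sup>+u. \<alpha> u * (\<integral>\<^sup>+y. \<beta> (u - 2 *\<^sub>R y) \<partial>lborel) \<partial>lborel)" .
  have scale: "ennreal (2 ^ DIM('a)) * (\<integral>\<^sup>+y. \<beta> (u - 2 *\<^sub>R y) \<partial>lborel) = (\<integral>\<^sup>+v. \<beta> v \<partial>lborel)" for u :: 'a
  proof -
    have "(\<integral>\<^sup>+v. \<beta> v \<partial>lborel)
        = (\<integral>\<^sup>+v. \<beta> v \<partial>density (distr lborel borel (\<lambda>x. u + (-2) *\<^sub>R x)) (\<lambda>_. ennreal (\<bar>-2\<bar> ^ DIM('a))))"
      by (subst lborel_affine[of "-2" u]) (simp_all add: ennreal_power)
    also have "\<dots> = (\<integral>\<^sup>+y. ennreal (2 ^ DIM('a)) * \<beta> (u - 2 *\<^sub>R y) \<partial>lborel)"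
      by (simp add: nn_integral_density nn_integral_distr)
    also have "\<dots> = ennreal (2 ^ DIM('a)) * (\<integral>\<^sup>+y. \<beta> (u - 2 *\<^sub>R y) \<partial>lborel)"
      by (rule nn_integral_cmult) simp
    finally show ?thesis ..
  qed
  have "ennreal (2 ^ DIM('a)) * (\<integral>\<^sup>+u. \<alpha> u * (\<integral>\<^sup>+y. \<beta> (u - 2 *\<^sub>R y) \<partial>lborel) \<partial>lborel)
      = (\<integral>\<^sup>+u. \<alpha> u * (ennreal (2 ^ DIM('a)) * (\<integral>\<^sup>+y. \<beta> (u - 2 *\<^sub>R y) \<partial>lborel)) \<partial>lborel)"
    by (subst nn_integral_cmult[symmetric]) (auto simp: ac_simps)
  also have "\<dots> = (\<integral>\<^sup>+u. \<alpha> u \<partial>lborel) * (\<integral>\<^sup>+v. \<beta> v \<partial>lborel)"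
    unfolding scale by (rule nn_integral_multc) simp
  finally show ?thesis unfolding * .
qed

definition gauss_density :: "real \<Rightarrow> real ^ 'd \<Rightarrow> ennreal" where
  "gauss_density \<sigma> x = ennreal (\<Prod>i\<in>UNIV. normal_density 0 \<sigma> (x $ i))"

text \<open>In each coordinate \<open>2 * (a\<^sup>2 + b\<^sup>2) = (a + b)\<^sup>2 + (a -
  b)\<^sup>2\<close>, so the joint density splits into a factor in the sum and a factor in the
  difference.\<close>

lemma gauss_density_mult:
  fixes x y :: "real ^ 'd"
  assumes "0 < \<sigma>"
  defines "E \<equiv> \<lambda>u :: real ^ 'd. ennreal (\<Prod>i\<in>UNIV. exp (- (u $ i)\<^sup>2 / (4 * \<sigma>\<^sup>2)))"
  shows "gauss_density \<sigma> x * gauss_density \<sigma> y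
    = ennreal (\<Prod>i\<in>(UNIV :: 'd set). 1 / (2 * pi * \<sigma>\<^sup>2)) * (E (x + y) * E (x - y))"
proof -
  have coord: "normal_density 0 \<sigma> a * normal_density 0 \<sigma> b =
      1 / (2 * pi * \<sigma>\<^sup>2) * (exp (- (a + b)\<^sup>2 / (4 * \<sigma>\<^sup>2)) * exp (- (a - b)\<^sup>2 / (4 * \<sigma>\<^sup>2)))" for a b :: real
  proof -
    have "- a\<^sup>2 / (2 * \<sigma>\<^sup>2) + - b\<^sup>2 / (2 * \<sigma>\<^sup>2) = - (a + b)\<^sup>2 / (4 * \<sigma>\<^sup>2) + - (a - b)\<^sup>2 / (4 * \<sigma>\<^sup>2)"
      using assms by (simp add: field_simps power2_eq_square)
    then have "exp (- a\<^sup>2 / (2 * \<sigma>\<^sup>2)) * exp (- b\<^sup>2 / (2 * \<sigma>\<^sup>2)) =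
        exp (- (a + b)\<^sup>2 / (4 * \<sigma>\<^sup>2)) * exp (- (a - b)\<^sup>2 / (4 * \<sigma>\<^sup>2))"
      by (simp only: exp_add[symmetric])
    moreover have "1 / sqrt (2 * pi * \<sigma>\<^sup>2) * (1 / sqrt (2 * pi * \<sigma>\<^sup>2)) = 1 / (2 * pi * \<sigma>\<^sup>2)"
      by (simp only: times_divide_times_eq real_sqrt_mult_self mult_1) simp
    moreover have "normal_density 0 \<sigma> a * normal_density 0 \<sigma> b =
       (1 / sqrt (2 * pi * \<sigma>\<^sup>2) * (1 / sqrt (2 * pi * \<sigma>\<^sup>2))) * (exp (- a\<^sup>2 / (2 * \<sigma>\<^sup>2)) * exp (- b\<^sup>2 / (2 * \<sigma>\<^sup>2)))"
      by (simp add: normal_density_def mult_ac)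
    ultimately show ?thesis by simp
  qed
  show ?thesis
    unfolding gauss_density_def E_def
    by (simp add: ennreal_mult[symmetric] prod_nonneg coord flip: prod.distrib del: prod_constant)
qed

lemma Int_stable_vimage: "Int_stable {X -` A \<inter> \<Omega> |A. A \<in> sets N}"
proof (rule Int_stableI)
  fix a b assume "a \<in> {X -` A \<inter> \<Omega> |A. A \<in> sets N}" "b \<in> {X -` A \<inter> \<Omega> |A. A \<in> sets N}"
  then obtain A B where "A \<in> sets N" "B \<in> sets N" "a = X -` A \<inter> \<Omega>" "b = X -` B \<inter> \<Omega>" by auto
  then show "a \<inter> b \<in> {X -` A \<inter> \<Omega> |A. A \<in> sets N}"
    by (auto intro!: exI[of _ "A \<inter> B"])
qed

text \<open>By the factorised density and the change of variables, the joint probability of the two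
  events is a constant times a function of \<open>A\<close> times the same function of
  \<open>B\<close>.\<close>

lemma (in prob_space) indep_var_sum_diff:
  fixes X Y :: "'a \<Rightarrow> real ^ 'd"
  assumes "0 < \<sigma>" and X: "distributed M lborel X (gauss_density \<sigma>)"
    and Y: "distributed M lborel Y (gauss_density \<sigma>)" and ind: "indep_var borel X borel Y"
    and AB: "A \<in> sets borel" "B \<in> sets borel"
  shows "prob ((\<lambda>\<omega>. X \<omega> + Y \<omega>) -` A \<inter> (\<lambda>\<omega>. X \<omega> - Y \<omega>) -` B \<inter> space M)
    = prob ((\<lambda>\<omega>. X \<omega> + Y \<omega>) -` A \<inter> space M) * prob ((\<lambda>\<omega>. X \<omega> - Y \<omega>) -` B \<inter> space M)"
proof -
  have [measurable]: "X \<in> borel_measurable M" "Y \<in> borel_measurable M"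
    using distributed_measurable[OF X] distributed_measurable[OF Y] by auto
  have [measurable]: "gauss_density \<sigma> \<in> borel_measurable (borel :: (real ^ 'd) measure)"
    using X by (auto simp: distributed_def)
  have "indep_var lborel X lborel Y"
    using ind unfolding indep_var_eq by simp
  then have XY: "distributed M (lborel \<Otimes>\<^sub>M lborel) (\<lambda>\<omega>. (X \<omega>, Y \<omega>))
      (\<lambda>(x, y). gauss_density \<sigma> x * gauss_density \<sigma> y)"
    by (intro distributed_joint_indep X Y sigma_finite_lborel)
  define E where "E u = ennreal (\<Prod>i\<in>UNIV. exp (- (u $ i)\<^sup>2 / (4 * \<sigma>\<^sup>2)))" for u :: "real ^ 'd"
  define K where "K = ennreal (\<Prod>i\<in>(UNIV :: 'd set). 1 / (2 * pi * \<sigma>\<^sup>2))"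
  define Q where "Q A B = emeasure M ((\<lambda>\<omega>. X \<omega> + Y \<omega>) -` A \<inter> (\<lambda>\<omega>. X \<omega> - Y \<omega>) -` B \<inter> space M)" for A B
  define a where "a A = (\<integral>\<^sup>+u. E u * indicator A u \<partial>lborel)" for A
  define q where "q = ennreal (2 ^ DIM(real ^ 'd))"
  have [measurable]: "E \<in> borel_measurable borel" unfolding E_def by measurable
  have Q: "q * Q A B = K * (a A * a B)" if [measurable]: "A \<in> sets borel" "B \<in> sets borel" for A B
  proof -
    let ?g = "\<lambda>z. indicator A (fst z + snd z) * indicator B (fst z - snd z) :: ennreal"
    have "Q A B = (\<integral>\<^sup>+\<omega>. indicator ((\<lambda>\<omega>. X \<omega> + Y \<omega>) -` A \<inter> (\<lambda>\<omega>. X \<omega> - Y \<omega>) -` B \<inter> space M) \<omega> \<partial>M)"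
      unfolding Q_def by (rule nn_integral_indicator[symmetric]) measurable
    also have "\<dots> = (\<integral>\<^sup>+\<omega>. ?g (X \<omega>, Y \<omega>) \<partial>M)"
      by (intro nn_integral_cong) (auto split: split_indicator)
    also have "\<dots> = (\<integral>\<^sup>+z. (case z of (x, y) \<Rightarrow> gauss_density \<sigma> x * gauss_density \<sigma> y) * ?g z \<partial>(lborel \<Otimes>\<^sub>M lborel))"
      by (rule distributed_nn_integral[OF XY, symmetric]) measurable
    also have "\<dots> = (\<integral>\<^sup>+x. \<integral>\<^sup>+y. (gauss_density \<sigma> x * gauss_density \<sigma> y) * ?g (x, y) \<partial>lborel \<partial>lborel)"
      by (subst lborel.nn_integral_fst[symmetric]) (simp_all add: split_beta')
    also have "\<dots> = (\<integral>\<^sup>+x. \<integral>\<^sup>+y. K * ((E (x + y) * indicator A (x + y)) * (E (x - y) * indicator B (x - y))) \<partial>lborel \<partial>lborel)"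
      unfolding gauss_density_mult[OF \<open>0 < \<sigma>\<close>] K_def E_def by (intro nn_integral_cong) (simp add: ac_simps)
    also have "\<dots> = K * (\<integral>\<^sup>+x. \<integral>\<^sup>+y. (E (x + y) * indicator A (x + y)) * (E (x - y) * indicator B (x - y)) \<partial>lborel \<partial>lborel)"
      by (simp add: nn_integral_cmult)
    finally have "q * Q A B = K * (q * (\<integral>\<^sup>+x. \<integral>\<^sup>+y. (E (x + y) * indicator A (x + y)) * (E (x - y) * indicator B (x - y)) \<partial>lborel \<partial>lborel))"
      by (simp add: ac_simps)
    also have "\<dots> = K * (a A * a B)"
      unfolding q_def a_def by (subst nn_integral_sum_diff) simp_all
    finally show ?thesis .
  qed
  have "Q UNIV UNIV = 1" unfolding Q_def by (simp add: emeasure_space_1)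
  then have q1: "q = K * (a UNIV * a UNIV)" using Q[of UNIV UNIV] by simp
  \<comment> \<open>Total mass one fixes the constants, so the Gaussian integrals need not be evaluated.\<close>
  have "q * (q * (Q A UNIV * Q UNIV B)) = (q * Q A UNIV) * (q * Q UNIV B)"
    by (simp add: ac_simps)
  also have "\<dots> = (K * (a UNIV * a UNIV)) * (K * (a A * a B))"
    using AB by (simp add: Q ac_simps)
  also have "\<dots> = q * (q * Q A B)"
    using AB by (simp add: Q q1[symmetric])
  finally have "Q A UNIV * Q UNIV B = Q A B"
    by (simp add: ennreal_mult_cancel_left q_def)
  then have "emeasure M ((\<lambda>\<omega>. X \<omega> + Y \<omega>) -` A \<inter> (\<lambda>\<omega>. X \<omega> - Y \<omega>) -` B \<inter> space M)
    = emeasure M ((\<lambda>\<omega>. X \<omega> + Y \<omega>) -` A \<inter> space M) * emeasure M ((\<lambda>\<omega>. X \<omega> - Y \<omega>) -` B \<inter> space M)"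
    by (simp add: Q_def)
  then show ?thesis
    by (simp add: emeasure_eq_measure flip: ennreal_mult)
qed

section \<open>Independence of the dyadic second differences\<close>

definition sigma_gen :: "'w set \<Rightarrow> ('i \<Rightarrow> 'w \<Rightarrow> 'a::topological_space) \<Rightarrow> 'w measure" where
  "sigma_gen \<Omega> X = sigma \<Omega> (\<Union>i. {X i -` A \<inter> \<Omega> |A. A \<in> sets borel})"

lemma space_sigma_gen [simp]: "space (sigma_gen \<Omega> X) = \<Omega>"
  unfolding sigma_gen_def by (rule space_measure_of) auto

lemma sets_sigma_gen:
  "sets (sigma_gen \<Omega> X) = sigma_sets \<Omega> (\<Union>i. {X i -` A \<inter> \<Omega> |A. A \<in> sets borel})"
  unfolding sigma_gen_def by (rule sets_measure_of) auto

lemma measurable_sigma_gen: "X i \<in> borel_measurable (sigma_gen \<Omega> X)"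
  by (rule measurableI) (auto simp: sets_sigma_gen)

lemma sets_sigma_gen_subset:
  assumes "space N = \<Omega>" "\<And>i. X i \<in> borel_measurable N"
  shows "sets (sigma_gen \<Omega> X) \<subseteq> sets N"
proof -
  have "(\<Union>i. {X i -` A \<inter> \<Omega> |A. A \<in> sets borel}) \<subseteq> sets N"
    using assms measurable_sets by blast
  then show ?thesis
    unfolding sets_sigma_gen using assms(1) sets.sigma_sets_subset by blast
qed

text \<open>Distinct pairs are independent because \<open>X\<close> is, and within a pair the sum
  and the difference are independent. Hence the whole family \<open>W\<close> is independent, and
  grouping it by its boolean index separates all sums from all differences.\<close>

lemma (in prob_space) indep_sums_diffs:
  fixes X :: "nat \<Rightarrow> 'a \<Rightarrow> real ^ 'd"
  assumes "0 < \<sigma>" and X: "\<And>k. distributed M lborel (X k) (gauss_density \<sigma>)"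
    and ind: "indep_vars (\<lambda>_. borel) X UNIV"
  shows "indep_set (sets (sigma_gen (space M) (\<lambda>k \<omega>. X (2 * k) \<omega> + X (2 * k + 1) \<omega>)))
    (sets (sigma_gen (space M) (\<lambda>k \<omega>. X (2 * k) \<omega> - X (2 * k + 1) \<omega>)))"
proof -
  have [measurable]: "X k \<in> borel_measurable M" for k
    using distributed_measurable[OF X] by simp
  define W :: "nat \<times> bool \<Rightarrow> 'a \<Rightarrow> real ^ 'd" where
    "W j \<omega> = (if snd j then X (2 * fst j) \<omega> + X (2 * fst j + 1) \<omega> else X (2 * fst j) \<omega> - X (2 * fst j + 1) \<omega>)" for j \<omega>
  define E where "E j = {W j -` A \<inter> space M |A. A \<in> sets borel}" for j
  have [measurable]: "W j \<in> borel_measurable M" for j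
    unfolding W_def[abs_def] by measurable
  have pairs: "indep_vars (\<lambda>_. borel \<Otimes>\<^sub>M borel) (\<lambda>k \<omega>. (X (2 * k) \<omega>, X (2 * k + 1) \<omega>)) UNIV"
  proof -
    have "disjoint_family_on (\<lambda>k::nat. {2 * k, 2 * k + 1}) UNIV"
      unfolding disjoint_family_on_def by auto
    then have "indep_vars (\<lambda>k. PiM {2 * k, 2 * k + 1} (\<lambda>_. borel))
        (\<lambda>k \<omega>. restrict (\<lambda>i. X i \<omega>) {2 * k, 2 * k + 1}) UNIV"
      by (intro indep_vars_restrict[OF ind]) auto
    then have "indep_vars (\<lambda>_. borel \<Otimes>\<^sub>M borel)
        (\<lambda>k \<omega>. (\<lambda>v. (v (2 * k), v (2 * k + 1))) (restrict (\<lambda>i. X i \<omega>) {2 * k, 2 * k + 1})) UNIV"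
      by (rule indep_vars_compose2) (intro measurable_Pair measurable_component_singleton; simp)
    then show ?thesis by simp
  qed
  have two: "indep_var borel (X (2 * k)) borel (X (2 * k + 1))" for k
    unfolding indep_var_eq
  proof (intro conjI indep_set_sigma_sets indep_setI Int_stable_vimage)
    fix a b assume "a \<in> {X (2 * k) -` A \<inter> space M |A. A \<in> sets borel}"
      "b \<in> {X (2 * k + 1) -` A \<inter> space M |A. A \<in> sets borel}"
    then obtain A B where "A \<in> sets borel" "B \<in> sets borel"
      "a = X (2 * k) -` A \<inter> space M" "b = X (2 * k + 1) -` B \<inter> space M" by blast
    then show "prob (a \<inter> b) = prob a * prob b"
      using indep_varsD[OF ind, of "{2 * k, 2 * k + 1}" "\<lambda>i. if i = 2 * k then A else B"] by simp
  qed auto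
  have "indep_sets E UNIV"
  proof (rule indep_setsI)
    show "E i \<subseteq> events" for i by (auto simp: E_def)
    fix A J assume J: "J \<noteq> {}" "finite J" and "\<forall>j\<in>J. A j \<in> E j"
    then have "\<forall>j\<in>J. \<exists>S. S \<in> sets borel \<and> A j = W j -` S \<inter> space M" by (auto simp: E_def)
    then obtain S where S: "\<And>j. j \<in> J \<Longrightarrow> S j \<in> sets borel" "\<And>j. j \<in> J \<Longrightarrow> A j = W j -` S j \<inter> space M"
      by metis
    \<comment> \<open>If only one member of a pair occurs in \<open>J\<close>, the other is given
      the trivial condition, which contributes a factor \<open>1\<close>.\<close>
    define S' where "S' j = (if j \<in> J then S j else UNIV)" for j
    have [measurable]: "S' j \<in> sets borel" for j using S by (auto simp: S'_def)
    define K where "K = fst ` J"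
    have K: "K \<noteq> {}" "finite K" using J by (auto simp: K_def)
    \<comment> \<open>Both conditions on the \<open>k\<close>-th pair form one Borel set of pairs,
      to which independence of the pairs applies.\<close>
    define R where "R k = {z \<in> space (borel \<Otimes>\<^sub>M borel). fst z + snd z \<in> S' (k, True) \<and> fst z - snd z \<in> S' (k, False)}" for k
    have R: "R k \<in> sets (borel \<Otimes>\<^sub>M borel)" for k unfolding R_def by measurable
    define P where "P k \<omega> = (X (2 * k) \<omega>, X (2 * k + 1) \<omega>)" for k \<omega>
    have PR: "P k -` R k \<inter> space M = W (k, True) -` S' (k, True) \<inter> W (k, False) -` S' (k, False) \<inter> space M" for k
      by (auto simp: P_def R_def W_def space_pair_measure)
    have "(\<Inter>j\<in>J. A j) = (\<Inter>k\<in>K. P k -` R k \<inter> space M)"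
    proof (rule set_eqI)
      fix \<omega>
      have "\<omega> \<in> (\<Inter>j\<in>J. A j) \<longleftrightarrow> \<omega> \<in> space M \<and> (\<forall>j\<in>J. W j \<omega> \<in> S' j)"
        using J S(2) by (auto simp: S'_def)
      also have "\<dots> \<longleftrightarrow> \<omega> \<in> space M \<and> (\<forall>k\<in>K. \<forall>b. W (k, b) \<omega> \<in> S' (k, b))"
        unfolding K_def by (auto simp: S'_def)
      also have "\<dots> \<longleftrightarrow> \<omega> \<in> (\<Inter>k\<in>K. P k -` R k \<inter> space M)"
        unfolding PR using K by (auto simp: all_bool_eq)
      finally show "\<omega> \<in> (\<Inter>j\<in>J. A j) \<longleftrightarrow> \<omega> \<in> (\<Inter>k\<in>K. P k -` R k \<inter> space M)" .
    qed
    then have "prob (\<Inter>j\<in>J. A j) = (\<Prod>k\<in>K. prob (P k -` R k \<inter> space M))"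
      using indep_varsD[OF pairs K(1,2), of R] R by (simp add: P_def[abs_def])
    also have "\<dots> = (\<Prod>k\<in>K. \<Prod>b\<in>UNIV. prob (W (k, b) -` S' (k, b) \<inter> space M))"
    proof (rule prod.cong[OF refl])
      fix k
      show "prob (P k -` R k \<inter> space M) = (\<Prod>b\<in>UNIV. prob (W (k, b) -` S' (k, b) \<inter> space M))"
        unfolding PR using indep_var_sum_diff[OF \<open>0 < \<sigma>\<close> X X two, of "S' (k, True)" "S' (k, False)" k]
        by (simp add: W_def[abs_def] UNIV_bool mult.commute)
    qed
    also have "\<dots> = (\<Prod>j\<in>K \<times> UNIV. prob (W j -` S' j \<inter> space M))"
      by (simp add: prod.cartesian_product)
    also have "\<dots> = (\<Prod>j\<in>J. prob (W j -` S' j \<inter> space M))"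
    proof (rule prod.mono_neutral_right)
      show "finite (K \<times> (UNIV :: bool set))" using K by simp
      show "J \<subseteq> K \<times> UNIV" by (force simp: K_def)
    qed (auto simp: S'_def prob_space)
    also have "\<dots> = (\<Prod>j\<in>J. prob (A j))"
      by (rule prod.cong) (auto simp: S S'_def)
    finally show "prob (\<Inter>j\<in>J. A j) = (\<Prod>j\<in>J. prob (A j))" .
  qed
  then have "indep_sets (\<lambda>b. sigma_sets (space M) (\<Union>j\<in>UNIV \<times> {b}. E j)) UNIV"
  proof (intro indep_sets_collect_sigma)
    assume "indep_sets E UNIV"
    then show "indep_sets E (\<Union>b\<in>UNIV. UNIV \<times> {b})"
      by (rule indep_sets_mono_index[rotated]) simp
  qed (auto simp: E_def Int_stable_vimage disjoint_family_on_def)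
  moreover have "(\<Union>j\<in>UNIV \<times> {b}. E j) = (\<Union>k. E (k, b))" for b by blast
  moreover have "E (k, True) = {(\<lambda>\<omega>. X (2 * k) \<omega> + X (2 * k + 1) \<omega>) -` A \<inter> space M |A. A \<in> sets borel}"
    "E (k, False) = {(\<lambda>\<omega>. X (2 * k) \<omega> - X (2 * k + 1) \<omega>) -` A \<inter> space M |A. A \<in> sets borel}" for k
    by (simp_all add: E_def W_def[abs_def])
  then have "case_bool (sets (sigma_gen (space M) (\<lambda>k \<omega>. X (2 * k) \<omega> + X (2 * k + 1) \<omega>)))
      (sets (sigma_gen (space M) (\<lambda>k \<omega>. X (2 * k) \<omega> - X (2 * k + 1) \<omega>)))
    = (\<lambda>b. sigma_sets (space M) (\<Union>k. E (k, b)))"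
    unfolding sets_sigma_gen by (intro ext) (simp split: bool.split)
  ultimately show ?thesis
    unfolding indep_set_def by simp
qed

text \<open>Induction on the largest index \<open>m\<close>: the intersection of the events with
  smaller indices lies in \<open>F m\<close>, which is independent of \<open>G m\<close>.\<close>

lemma (in prob_space) indep_sets_chain:
  fixes F G :: "nat \<Rightarrow> 'a set set"
  assumes ind: "\<And>m. indep_set (F m) (G m)"
    and GF: "\<And>m. G m \<subseteq> F (Suc m)" and FF: "\<And>m. F m \<subseteq> F (Suc m)"
    and Int: "\<And>m a b. a \<in> F m \<Longrightarrow> b \<in> F m \<Longrightarrow> a \<inter> b \<in> F m"
  shows "indep_sets G UNIV"
proof (rule indep_setsI)
  show "G i \<subseteq> events" for i using indep_setD_ev2[OF ind] .
  fix A J assume J: "J \<noteq> {}" "finite (J::nat set)" and A: "\<forall>j\<in>J. A j \<in> G j"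
  have mono: "F i \<subseteq> F j" if "i \<le> j" for i j
    using FF that by (rule lift_Suc_mono_le)
  have AF: "A j \<in> F m" if "j \<in> J" "j < m" for j m
    using A that GF[of j] mono[of "Suc j" m] by auto
  have FI: "(\<Inter>j\<in>I. A j) \<in> F m" if "I \<noteq> {}" "finite I" "I \<subseteq> J" "\<forall>j\<in>I. j < m" for I m
    using that(2,1,3,4) by (induction rule: finite_ne_induct) (auto intro!: Int AF)
  show "prob (\<Inter>j\<in>J. A j) = (\<Prod>j\<in>J. prob (A j))"
  proof -
    have "I \<noteq> {} \<longrightarrow> I \<subseteq> J \<longrightarrow> prob (\<Inter>j\<in>I. A j) = (\<Prod>j\<in>I. prob (A j))" if "finite I" for I
      using that
    proof (induction I rule: finite_linorder_max_induct)
      case (insert m I)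
      then have "m \<notin> I" by auto
      show ?case
      proof (cases "I = {}")
        case False
        show ?thesis
        proof (intro impI)
          assume "insert m I \<subseteq> J"
          then have "prob ((\<Inter>j\<in>I. A j) \<inter> A m) = prob (\<Inter>j\<in>I. A j) * prob (A m)"
            using insert False A by (intro indep_setD[OF ind[of m]] FI) auto
          then show "prob (\<Inter>j\<in>insert m I. A j) = (\<Prod>j\<in>insert m I. prob (A j))"
            using insert False \<open>insert m I \<subseteq> J\<close> \<open>m \<notin> I\<close> by (simp add: Int_commute mult.commute)
        qed
      qed simp
    qed simp
    then show ?thesis using J by blast
  qed
qed

text \<open>
  Each \<open>D n\<close> is only almost surely equal to \<open>D'\<close>; the upper limit of the \<open>D n\<close> is measurable with
  respect to the tail itself, so that Kolmogorov's law applies to it.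
\<close>

lemma (in prob_space) tail_measurable_AE_const:
  fixes G :: "nat \<Rightarrow> 'a measure" and D :: "nat \<Rightarrow> 'a \<Rightarrow> ereal"
  assumes sp: "\<And>n. space (G n) = space M" and ind: "indep_sets (\<lambda>n. sets (G n)) UNIV"
    and D: "\<And>n. D n \<in> borel_measurable (sigma (space M) (\<Union>i\<in>{n..}. sets (G i)))"
    and eq: "AE \<omega> in M. \<forall>n. D n \<omega> = D' \<omega>"
  shows "\<exists>c. AE \<omega> in M. D' \<omega> = c"
proof -
  let ?T = "\<lambda>n. sigma (space M) (\<Union>i\<in>{n..}. sets (G i))"
  have Pow: "(\<Union>i\<in>{n..}. sets (G i)) \<subseteq> Pow (space M)" for n
    using sp sets.sets_into_space by fastforce
  define L where "L \<omega> = limsup (\<lambda>n. D n \<omega>)" for \<omega>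
  have L: "L \<in> borel_measurable (?T n)" for n
  proof -
    have "D (k + n) \<in> borel_measurable (?T n)" for k
    proof (rule subsetD[OF measurable_mono1 D])
      show "(\<Union>i\<in>{k + n..}. sets (G i)) \<subseteq> (\<Union>i\<in>{n..}. sets (G i))" by (intro UN_mono) auto
    qed (rule Pow)
    then have "(\<lambda>\<omega>. limsup (\<lambda>k. D (k + n) \<omega>)) \<in> borel_measurable (?T n)"
      by (rule borel_measurable_limsup)
    moreover have "limsup (\<lambda>k. D (k + n) \<omega>) = L \<omega>" for \<omega>
      unfolding L_def by (rule limsup_shift_k)
    ultimately show ?thesis by simp
  qed
  have tail: "{\<omega> \<in> space M. L \<omega> \<le> q} \<in> tail_events (\<lambda>n. sets (G n))" for q
  proof -
    have "{\<omega> \<in> space (?T n). L \<omega> \<le> q} \<in> sets (?T n)" for n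
      using L[of n] by measurable
    then show ?thesis using Pow by (simp add: tail_events_def space_measure_of sets_measure_of)
  qed
  have sub: "sets (G n) \<subseteq> events" for n
    using ind by (auto simp: indep_sets_def)
  have ev: "{\<omega> \<in> space M. L \<omega> \<le> q} \<in> events" for q
    using tail tail_events_sets[of "\<lambda>n. sets (G n)"] sub by blast
  have 01: "prob {\<omega> \<in> space M. L \<omega> \<le> q} = 0 \<or> prob {\<omega> \<in> space M. L \<omega> \<le> q} = 1" for q
    using sets.sigma_algebra_axioms[of "G _"] by (intro kolmogorov_0_1_law[OF _ ind tail]) (simp add: sp)
  have "AE \<omega> in M. L \<omega> \<le> q \<longleftrightarrow> prob {\<omega> \<in> space M. L \<omega> \<le> q} = 1" for q
  proof (cases "prob {\<omega> \<in> space M. L \<omega> \<le> q} = 1")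
    case True
    with ev show ?thesis using AE_prob_1[OF True] by (auto elim: eventually_mono)
  next
    case False
    then have "prob {\<omega> \<in> space M. L \<omega> \<le> q} = 0" using 01 by blast
    then have "emeasure M {\<omega> \<in> space M. L \<omega> \<le> q} = 0" by (simp add: emeasure_eq_measure)
    then have "AE \<omega> in M. \<not> L \<omega> \<le> q" using ev by (subst AE_iff_measurable[OF _ refl]) auto
    then show ?thesis using False by (auto elim: eventually_mono)
  qed
  \<comment> \<open>Countably many null sets can be discarded together, and the rational upper
    bounds of an extended real determine it. The constant is thus the value of \<open>L\<close> at
    any one good sample point.\<close>
  then have "AE \<omega> in M. \<forall>q\<in>(\<rat> :: real set). L \<omega> \<le> ereal q \<longleftrightarrow> prob {\<omega> \<in> space M. L \<omega> \<le> ereal q} = 1"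
    by (simp add: AE_ball_countable countable_rat)
  with eq have ae: "AE \<omega> in M. (\<forall>q\<in>(\<rat> :: real set). L \<omega> \<le> ereal q \<longleftrightarrow> prob {\<omega> \<in> space M. L \<omega> \<le> ereal q} = 1) \<and> L \<omega> = D' \<omega>"
    by eventually_elim (simp add: L_def Limsup_const)
  then obtain \<omega>0 where \<omega>0: "\<forall>q\<in>(\<rat> :: real set). L \<omega>0 \<le> ereal q \<longleftrightarrow> prob {\<omega> \<in> space M. L \<omega> \<le> ereal q} = 1"
    using eventually_happens[OF ae] by (auto simp: ae_filter_eq_bot_iff emeasure_space_1)
  have inj: "x = y" if "\<And>q::real. q \<in> \<rat> \<Longrightarrow> x \<le> ereal q \<longleftrightarrow> y \<le> ereal q" for x y :: ereal
  proof (rule ccontr)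
    assume "x \<noteq> y"
    have *: False if uv: "u < v" and q: "\<And>q::real. q \<in> \<rat> \<Longrightarrow> u \<le> ereal q \<longleftrightarrow> v \<le> ereal q" for u v :: ereal
    proof -
      obtain r s :: real where "u < ereal r" "r < s" "ereal s < v"
        using ereal_dense2[OF uv] ereal_dense2 by (metis less_ereal.simps(1))
      moreover then obtain q where "q \<in> \<rat>" "r < q" "q < s" using Rats_dense_in_real by blast
      ultimately have "u \<le> ereal q" "\<not> v \<le> ereal q"
        by (meson less_ereal.simps(1) less_imp_le order.strict_trans not_le)+
      with q[OF \<open>q \<in> \<rat>\<close>] show False by simp
    qed
    from \<open>x \<noteq> y\<close> that *[of x y] *[of y x] show False by (metis linorder_neqE)
  qed
  from ae have "AE \<omega> in M. D' \<omega> = L \<omega>0"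
    by eventually_elim (use \<omega>0 inj in metis)
  then show ?thesis by blast
qed

section \<open>Brownian motion\<close>

context standard_brownian_motion
begin

abbreviation incr :: "nat \<Rightarrow> nat \<Rightarrow> 'w \<Rightarrow> real ^ 'd" where
  "incr m k \<omega> \<equiv> dyadic_incr (\<lambda>t. B t \<omega>) m k"

abbreviation diff :: "nat \<Rightarrow> nat \<Rightarrow> 'w \<Rightarrow> real ^ 'd" where
  "diff m k \<omega> \<equiv> dyadic_diff (\<lambda>t. B t \<omega>) m k"

lemma measurable_incr [measurable]: "incr m k \<in> borel_measurable M"
  unfolding dyadic_incr_def[abs_def]
  by (intro borel_measurable_diff measurable_at) auto

lemma distributed_incr: "distributed M lborel (incr m k) (gauss_density (sqrt (1 / 2 ^ m)))"
proof -
  have "real k / 2 ^ m < (real k + 1) / 2 ^ m" by (simp add: divide_strict_right_mono)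
  then have "distributed M lborel (incr m k)
      (\<lambda>x. ennreal (\<Prod>i\<in>UNIV. normal_density 0 (sqrt ((real k + 1) / 2 ^ m - real k / 2 ^ m)) (x $ i)))"
    unfolding dyadic_incr_def by (intro gaussian_increments) auto
  moreover have "(real k + 1) / 2 ^ m - real k / 2 ^ m = 1 / 2 ^ m"
    by (simp add: field_simps)
  ultimately show ?thesis unfolding gauss_density_def[abs_def] by simp
qed

text \<open>The locale provides finitely many increments at a time; independence of an infinite
  family is a condition on its finite subfamilies.\<close>

lemma indep_incr: "indep_vars (\<lambda>_. borel) (incr m) UNIV"
proof -
  have fin: "indep_vars (\<lambda>_. borel) (incr m) {..<n}" for n
    using independent_increments[of "\<lambda>i. real i / 2 ^ m" n]
    by (simp add: dyadic_incr_def[abs_def] divide_right_mono add.commute)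
  show ?thesis
    unfolding indep_vars_def2
  proof (intro conjI ballI)
    show "indep_sets (\<lambda>k. {incr m k -` A \<inter> space M |A. A \<in> sets borel}) UNIV"
      unfolding indep_sets_finite_index_sets[of _ UNIV]
    proof (intro allI impI)
      fix J :: "nat set" assume "finite J"
      then obtain n where "J \<subseteq> {..<n}" by (metis finite_nat_iff_bounded)
      with fin[of n] show "indep_sets (\<lambda>k. {incr m k -` A \<inter> space M |A. A \<in> sets borel}) J"
        unfolding indep_vars_def2 by (auto intro: indep_sets_mono_index)
    qed
  qed simp
qed

text \<open>The chain is applied with the increments of level \<open>m\<close> as
  \<open>F m\<close>. Both they and the second differences of level \<open>m\<close> are functions
  of the increments of level \<open>Suc m\<close>, as sums and differences over neighbouring
  pairs.\<close>

lemma indep_diff: "indep_sets (\<lambda>m. sets (sigma_gen (space M) (diff m))) UNIV"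
proof (rule indep_sets_chain[where F="\<lambda>m. sets (sigma_gen (space M) (incr m))"])
  fix m
  note [measurable] = measurable_sigma_gen[where X="incr (Suc m)" and \<Omega>="space M"]
  have eq: "incr m = (\<lambda>k \<omega>. incr (Suc m) (2 * k) \<omega> + incr (Suc m) (2 * k + 1) \<omega>)"
    using dyadic_incr_split by (intro ext) blast
  show "indep_set (sets (sigma_gen (space M) (incr m))) (sets (sigma_gen (space M) (diff m)))"
    unfolding eq dyadic_diff_def
    by (rule indep_sums_diffs[OF _ distributed_incr indep_incr]) simp
  show "sets (sigma_gen (space M) (diff m)) \<subseteq> sets (sigma_gen (space M) (incr (Suc m)))"
    unfolding dyadic_diff_def by (rule sets_sigma_gen_subset) simp_all
  show "sets (sigma_gen (space M) (incr m)) \<subseteq> sets (sigma_gen (space M) (incr (Suc m)))"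
    unfolding eq by (rule sets_sigma_gen_subset) simp_all
qed auto

text \<open>
  Equals \<open>B - dyadic_interp n B\<close> on continuous paths; the limit is a function of the second differences
  of level at least \<open>n\<close> alone.
\<close>

definition bridge :: "nat \<Rightarrow> real \<Rightarrow> 'w \<Rightarrow> real ^ 'd" where
  "bridge n t \<omega> = lim (\<lambda>N. dyadic_interp (n + N) (\<lambda>t. B t \<omega>) t - dyadic_interp n (\<lambda>t. B t \<omega>) t)"

lemma bridge_eq:
  assumes "continuous_on {0..} (\<lambda>t. B t \<omega>)" "0 \<le> t" "t \<le> 1"
  shows "bridge n t \<omega> = B t \<omega> - dyadic_interp n (\<lambda>t. B t \<omega>) t"
proof -
  have "(\<lambda>N. dyadic_interp (n + N) (\<lambda>t. B t \<omega>) t) \<longlonglongrightarrow> B t \<omega>"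
    using LIMSEQ_ignore_initial_segment[OF dyadic_interp_tendsto[OF assms], of n]
    by (simp add: add.commute)
  then show ?thesis
    unfolding bridge_def by (intro limI tendsto_diff tendsto_const)
qed

text \<open>Telescoping over levels: each refinement adds a deterministic multiple of one second
  difference of level at least \<open>n\<close>. Measurability of \<open>lim\<close> covers the
  sample points without convergence as well.\<close>

lemma measurable_bridge:
  assumes "0 \<le> t" "t \<le> 1"
  shows "bridge n t \<in> borel_measurable (sigma (space M) (\<Union>i\<in>{n..}. sets (sigma_gen (space M) (diff i))))"
    (is "_ \<in> borel_measurable ?T")
proof -
  have Pow: "(\<Union>i\<in>{n..}. sets (sigma_gen (space M) (diff i))) \<subseteq> Pow (space M)"
    using sets.sets_into_space by fastforce
  have diff: "diff (n + i) k \<in> borel_measurable ?T" for i k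
  proof (rule measurableI)
    fix A :: "(real ^ 'd) set" assume "A \<in> sets borel"
    from measurable_sets[OF measurable_sigma_gen this]
    have "diff (n + i) k -` A \<inter> space M \<in> sets (sigma_gen (space M) (diff (n + i)))" by simp
    then have "diff (n + i) k -` A \<inter> space M \<in> (\<Union>i\<in>{n..}. sets (sigma_gen (space M) (diff i)))"
      by (intro UN_I[of "n + i"]) auto
    then show "diff (n + i) k -` A \<inter> space ?T \<in> sets ?T"
      using Pow by (simp add: space_measure_of)
  qed simp
  have "(\<lambda>\<omega>. dyadic_interp (n + N) (\<lambda>t. B t \<omega>) t - dyadic_interp n (\<lambda>t. B t \<omega>) t) \<in> borel_measurable ?T" for N
  proof (induction N)
    case (Suc N)
    obtain c k where ck: "\<And>b :: real \<Rightarrow> real ^ 'd.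
      dyadic_interp (Suc (n + N)) b t - dyadic_interp (n + N) b t = c *\<^sub>R dyadic_diff b (n + N) k"
      by (rule dyadic_interp_Suc[OF assms, where m="n + N"]) (rule that)
    have "dyadic_interp (n + Suc N) b t - dyadic_interp n b t =
      c *\<^sub>R dyadic_diff b (n + N) k + (dyadic_interp (n + N) b t - dyadic_interp n b t)" for b :: "real \<Rightarrow> real ^ 'd"
      using ck[of b] by (simp add: algebra_simps)
    then show ?case
      by (simp only:) (intro borel_measurable_add borel_measurable_scaleR borel_measurable_const Suc diff)
  qed simp
  then show ?thesis
    unfolding bridge_def[abs_def] by (rule borel_measurable_lim_metric)
qed

text \<open>For a continuous path and every \<open>n\<close>, passing to \<open>A'\<close> and
  removing the level-\<open>n\<close> interpolation leave both rates unchanged. Each thus has, for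
  every \<open>n\<close>, a version measurable with respect to the levels from \<open>n\<close>
  on.\<close>

lemma rates_const:
  assumes "A \<subseteq> {0..1}"
  shows "\<exists>c. AE \<omega> in M. upper_rate (graph_over A (\<lambda>t. B t \<omega> + f t)) = c"
    "\<exists>c. AE \<omega> in M. lower_rate (graph_over A (\<lambda>t. B t \<omega> + f t)) = c"
proof -
  obtain A' where A': "countable A'" "A' \<subseteq> A"
    "\<And>b. continuous_on A b \<Longrightarrow> graph_over A (\<lambda>t. b t + f t) \<subseteq> closure (graph_over A' (\<lambda>t. b t + f t))"
    by (rule countable_graph_dense[of A f]) (rule that)
  have bridge: "upper_rate (graph_over A' (\<lambda>t. bridge n t \<omega> + f t)) = upper_rate (graph_over A (\<lambda>t. B t \<omega> + f t)) \<and>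
      lower_rate (graph_over A' (\<lambda>t. bridge n t \<omega> + f t)) = lower_rate (graph_over A (\<lambda>t. B t \<omega> + f t))"
    if c: "continuous_on {0..} (\<lambda>t. B t \<omega>)" for n \<omega>
  proof -
    have "continuous_on A (\<lambda>t. B t \<omega>)"
      using c by (rule continuous_on_subset) (use assms in auto)
    note dense = rates_dense[OF _ A'(3)[OF this]]
    have sub: "graph_over A' (\<lambda>t. B t \<omega> + f t) \<subseteq> graph_over A (\<lambda>t. B t \<omega> + f t)"
      using A'(2) by (auto simp: graph_over_def)
    have eq: "graph_over A' (\<lambda>t. B t \<omega> + f t) =
      graph_over A' (\<lambda>t. (bridge n t \<omega> + f t) + dyadic_interp n (\<lambda>t. B t \<omega>) t)"
      unfolding graph_over_def using A'(2) assms by (intro image_cong) (auto simp: bridge_eq[OF c])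
    obtain K where "K-lipschitz_on A' (dyadic_interp n (\<lambda>t. B t \<omega>))"
      using dyadic_interp_lipschitz by blast
    from rates_graph_add_lipschitz[OF this, of "\<lambda>t. bridge n t \<omega> + f t"]
    show ?thesis using dense[OF sub] eq by simp
  qed
  let ?G = "\<lambda>m. sigma_gen (space M) (diff m)"
  have m: "(\<lambda>\<omega>. bridge n t \<omega> + f t) \<in> borel_measurable (sigma (space M) (\<Union>i\<in>{n..}. sets (?G i)))"
    if "t \<in> A'" for n t
    using that A' assms by (intro borel_measurable_add measurable_bridge) auto
  show "\<exists>c. AE \<omega> in M. upper_rate (graph_over A (\<lambda>t. B t \<omega> + f t)) = c"
    by (rule tail_measurable_AE_const[OF _ indep_diff measurable_rates_graph(1)[OF A'(1) m]])
      (use continuous_paths bridge in \<open>auto elim: eventually_mono\<close>)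
  show "\<exists>c. AE \<omega> in M. lower_rate (graph_over A (\<lambda>t. B t \<omega> + f t)) = c"
    by (rule tail_measurable_AE_const[OF _ indep_diff measurable_rates_graph(2)[OF A'(1) m]])
      (use continuous_paths bridge in \<open>auto elim: eventually_mono\<close>)
qed

end

theorem theorem1p3:
  fixes M :: "'w measure"
    and B :: "real \<Rightarrow> 'w \<Rightarrow> real ^ 'd"
    and f :: "real \<Rightarrow> real ^ 'd"
    and A :: "real set"
  assumes "standard_brownian_motion M B"
    and "cadlag_on 0 1 f"
    and "A \<noteq> {}" and "A \<subseteq> {0..1}"
  shows "\<exists>c3 c4 :: real. AE \<omega> in M.
           lower_minkowski_dim (graph_over A (\<lambda>t. B t \<omega> + f t)) = ereal c3 \<and>
           upper_minkowski_dim (graph_over A (\<lambda>t. B t \<omega> + f t)) = ereal c4"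
proof -
  interpret standard_brownian_motion M B by fact
  obtain l u where "AE \<omega> in M. lower_rate (graph_over A (\<lambda>t. B t \<omega> + f t)) = l"
    "AE \<omega> in M. upper_rate (graph_over A (\<lambda>t. B t \<omega> + f t)) = u"
    using rates_const[OF assms(4), of f] by blast
  then have ae: "AE \<omega> in M. bounded (graph_over A (\<lambda>t. B t \<omega> + f t)) \<and>
      lower_minkowski_dim (graph_over A (\<lambda>t. B t \<omega> + f t)) = l \<and>
      upper_minkowski_dim (graph_over A (\<lambda>t. B t \<omega> + f t)) = u"
    using continuous_paths
  proof eventually_elim
    case (elim \<omega>)
    have "compact ((\<lambda>t. B t \<omega>) ` {0..1})"
      by (rule compact_continuous_image[OF continuous_on_subset[OF elim(3)]]) auto
    then have "bounded ((\<lambda>t. B t \<omega>) ` A)"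
      using compact_imp_bounded bounded_subset image_mono[OF assms(4)] by metis
    moreover have "bounded (f ` A)"
      using bounded_subset[OF cadlag_on_bounded[OF assms(2)] image_mono[OF assms(4)]] .
    ultimately have "bounded ((\<lambda>t. B t \<omega> + f t) ` A)"
      by (rule bounded_plus_comp)
    moreover have "bounded A" using bounded_subset[OF bounded_closed_interval assms(4)] by simp
    ultimately have "bounded (graph_over A (\<lambda>t. B t \<omega> + f t))"
      by (intro bounded_graph_over)
    with elim show ?case by (simp add: minkowski_dim_eq_rate)
  qed
  \<comment> \<open>The constants \<open>l\<close> and \<open>u\<close> are extended reals so far; a
    single good sample point with a bounded graph shows that they are finite.\<close>
  then obtain \<omega> where "bounded (graph_over A (\<lambda>t. B t \<omega> + f t))"
      "lower_minkowski_dim (graph_over A (\<lambda>t. B t \<omega> + f t)) = l"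
      "upper_minkowski_dim (graph_over A (\<lambda>t. B t \<omega> + f t)) = u"
    using eventually_happens[OF ae] by (auto simp: ae_filter_eq_bot_iff emeasure_space_1)
  then have "\<bar>l\<bar> \<noteq> \<infinity>" "\<bar>u\<bar> \<noteq> \<infinity>"
    using rates_finite minkowski_dim_eq_rate by metis+
  then obtain c3 c4 where "l = ereal c3" "u = ereal c4" by auto
  with ae show ?thesis
    by (intro exI[of _ c3] exI[of _ c4]) (auto elim: eventually_mono)
qed

end
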